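(* Let $\Omega_0\subset\mathbb{R}^2$ be a bounded domain with smooth boundary such that for some $c_0>0$ $$\Omega_0\cap\big((-c_0,c_0)\times(-c_0,c_0)\big)=\{(x,y):|x|<c_0,\ -c_0<y\le f(x)<c_0\},$$ where $f$ is an even $C^2$ function with $f(0)=f'(0)=0$ and $f''(0)=-\kappa\le0$. For $\mu>0$ and $\tau=\mu h$, let $w^{m,n}(t)$ be the solution of the semi-discrete heat equation with step $h$ and initial data $1$ on lattice points of $\Omega_0$ and $0$ elsewhere (see context). For each $\mu$ let $n_0=n_0(\mu)\in\mathbb{Z}$ be such that, for all sufficiently small $h>0$ (with $\tau=\mu h$), $$w^{0,-n_0}(\tau)\le\tfrac12\quad\text{and}\quad w^{0,-n_0-1}(\tau)>\tfrac12 .$$ Then $$\lim_{\mu\to\infty}\frac{n_0}{\mu}=\kappa .$$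
   Context: For $h>0$, $\{w^{m,n}(t)\}_{(m,n)\in\mathbb{Z}^2}$, $t\ge0$, is the bounded solution of $$\frac{d}{dt}w^{m,n}=\frac1{h^2}\left[w^{m+1,n}+w^{m-1,n}+w^{m,n+1}+w^{m,n-1}-4w^{m,n}\right],$$ with $w^{m,n}(0)=1$ if $(mh,nh)\in\Omega_0$ and $w^{m,n}(0)=0$ otherwise. The superscripts $(m,n)$ refer to the lattice point $(mh,nh)$. The integer $n_0$ is called the discrete normal velocity of the boundary point $(0,0)$; $\kappa$ is the curvature of $\partial\Omega_0$ there. *)

theory Defs
  imports "HOL-Analysis.Analysis"
begin

(* Only the interior is required to be open and connected: in the local description of the
   initial set the boundary points y = f x belong to the set, so the set itself lies between
   an open domain and its closure. The function phi is a local C^2 defining function with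
   gradient G and Hessian H. *)
definition bounded_C2_domain :: "(real \<times> real) set \<Rightarrow> bool" where
  "bounded_C2_domain \<Omega> \<longleftrightarrow>
     bounded \<Omega> \<and> interior \<Omega> \<noteq> {} \<and> connected (interior \<Omega>) \<and>
     (\<forall>p \<in> frontier \<Omega>. \<exists>U (\<phi> :: real \<times> real \<Rightarrow> real) (G :: real \<times> real \<Rightarrow> real \<times> real)
        (H :: real \<times> real \<Rightarrow> (real \<times> real) \<Rightarrow>\<^sub>L (real \<times> real)).
        open U \<and> p \<in> U \<and>
        (\<forall>q \<in> U. (\<phi> has_derivative (\<lambda>v. G q \<bullet> v)) (at q) \<and>
                 (G has_derivative blinfun_apply (H q)) (at q) \<and> G q \<noteq> 0) \<and>
        continuous_on U H \<and>
        interior \<Omega> \<inter> U = {q \<in> U. \<phi> q < 0} \<and>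
        frontier \<Omega> \<inter> U = {q \<in> U. \<phi> q = 0})"

definition bounded_heat_solution ::
    "(real \<times> real) set \<Rightarrow> real \<Rightarrow> (int \<Rightarrow> int \<Rightarrow> real \<Rightarrow> real) \<Rightarrow> bool" where
  "bounded_heat_solution \<Omega> h w \<longleftrightarrow>
     (\<exists>B. \<forall>m n. \<forall>t\<ge>0. \<bar>w m n t\<bar> \<le> B) \<and>
     (\<forall>m n. \<forall>t\<ge>0. (w m n has_real_derivative
        (1 / h\<^sup>2) * (w (m + 1) n t + w (m - 1) n t + w m (n + 1) t + w m (n - 1) t - 4 * w m n t))
        (at t within {0..})) \<and>
     (\<forall>m n. w m n 0 = (if (of_int m * h, of_int n * h) \<in> \<Omega> then 1 else 0))"

end

theory Submission
  imports Defs "HOL-Real_Asymp.Real_Asymp"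
begin

text \<open>The bounded solution is \<open>w\<^sup>0\<^sup>,\<^sup>n(\<tau>) = P((X h, (n + Y) h) \<in> \<Omega>\<^sub>0)\<close> for independent continuous-time simple
  random walks \<open>X\<close>, \<open>Y\<close> on the integers at time \<open>T = \<tau> / h\<^sup>2 = \<mu> / h\<close>. Near the origin membership reads
  \<open>n + Y \<le> f (X h) / h\<close>, where \<open>f (X h) / h\<close> is close to \<open>- \<kappa> h X\<^sup>2 / 2\<close>, and the walks leave the
  local chart with probability \<open>O(T h\<^sup>2)\<close>. Since \<open>P(Y \<le> k) = 1/2 + q (k + O(1))\<close> with \<open>q\<close> of order
  \<open>T\<^sup>-\<^sup>1\<^sup>/\<^sup>2\<close>, up to an error controlled by the second and fourth moments, and \<open>E X\<^sup>2 = 2 T\<close>, one gets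
  \<open>w\<^sup>0\<^sup>,\<^sup>n(\<tau>) - 1/2 = q (- \<kappa> \<mu> - n + O(1))\<close>. Hence \<open>n\<^sub>0 = \<kappa> \<mu> + O(1)\<close>.\<close>

section \<open>The heat kernel on the integers\<close>

text \<open>The height q is never evaluated. Only the sign of w - 1/2 matters, so every error is
  measured in multiples of q, and q cancels. A lower bound of order T^(-1/2) is enough: the
  probability of leaving the chart is O(\<mu> h), q is at least of order (h/\<mu>)^(1/2), and their
  quotient vanishes as h tends to 0 for fixed \<mu>. The nonlinearity of the distribution function
  disappears in the same limit, because the curvature coefficient a = b h / 2 makes a T independent
  of h. Only the rounding to lattice sites survives. It costs at most 1 for every \<mu>, so division
  by \<mu> removes it. The moments and the flatness of the kernel p near its centre rest on k p(k) =
  T (p(k-1) - p(k+1)), the lattice form of x g = -2 T g' for the Gaussian density g of variance 2 T.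
  It replaces any local limit theorem. Its defect is that it never relates an even site to an odd
  one.\<close>

text \<open>The modified Bessel function is \<open>I\<^sub>k (2 T) = T\<^sup>k bessel_series k (T\<^sup>2)\<close>.\<close>

definition bessel_series :: "nat \<Rightarrow> real \<Rightarrow> real" where
  "bessel_series k x = (\<Sum>i. 1 / (fact i * fact (i + k)) * x ^ i)"

lemma summable_bessel_series: "summable (\<lambda>i. 1 / (fact i * fact (i + k)) * (x::real) ^ i)"
proof (rule summable_comparison_test')
  show "summable (\<lambda>i. \<bar>x\<bar> ^ i /\<^sub>R fact i)"
    using summable_exp_generic by blast
  fix i :: nat
  have "1 \<le> (fact (i + k) :: real)" by (rule fact_ge_1)
  hence "\<bar>x\<bar> ^ i / (fact i * fact (i + k)) \<le> \<bar>x\<bar> ^ i / (fact i * 1)"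
    by (intro divide_left_mono mult_left_mono) auto
  thus "norm (1 / (fact i * fact (i + k)) * x ^ i) \<le> \<bar>x\<bar> ^ i /\<^sub>R fact i"
    by (simp add: abs_mult power_abs divide_inverse mult.commute)
qed

lemma bessel_series_deriv:
  "(bessel_series k has_real_derivative bessel_series (Suc k) x) (at x)"
proof -
  have "((\<lambda>x. \<Sum>i. 1 / (fact i * fact (i + k)) * x ^ i) has_real_derivative
      (\<Sum>i. diffs (\<lambda>i. 1 / (fact i * fact (i + k))) i * x ^ i)) (at x)"
    by (rule termdiffs_strong_converges_everywhere) (rule summable_bessel_series)
  moreover have "diffs (\<lambda>i. 1 / (fact i * fact (i + k)) :: real) i =
      1 / (fact i * fact (i + Suc k))" for i
    by (simp add: diffs_def divide_simps del: of_nat_Suc)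
  ultimately show ?thesis
    unfolding bessel_series_def[abs_def] by simp
qed

lemma bessel_series_nonneg: "0 \<le> x \<Longrightarrow> 0 \<le> bessel_series k x"
  unfolding bessel_series_def by (intro suminf_nonneg summable_bessel_series) auto

text \<open>Coefficientwise this is (k + 1) + i = i + k + 1 over the common denominator i! (i + k +
  1)!.\<close>

lemma bessel_series_recurrence:
  "bessel_series k x = real (Suc k) * bessel_series (Suc k) x + x * bessel_series (Suc (Suc k)) x"
proof -
  let ?b = "\<lambda>k i. 1 / (fact i * fact (i + k)) * x ^ i"
  have s: "(\<lambda>i. ?b k i) sums bessel_series k x" for k
    unfolding bessel_series_def by (intro summable_sums summable_bessel_series)
  \<comment> \<open>The series for \<open>x * bessel_series (Suc (Suc k)) x\<close>, shifted by one
    index so that its powers of \<open>x\<close> line up; the default 0 fills the missing constant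
    term.\<close>
  define c where "c i = (if i = 0 then 0 else x * ?b (Suc (Suc k)) (i - 1))" for i
  have "(\<lambda>i. x * ?b (Suc (Suc k)) i) sums (x * bessel_series (Suc (Suc k)) x)"
    by (intro sums_mult s)
  hence "c sums (x * bessel_series (Suc (Suc k)) x)"
    using sums_Suc_iff[of c "x * bessel_series (Suc (Suc k)) x"] by (simp add: c_def)
  hence "(\<lambda>i. real (Suc k) * ?b (Suc k) i + c i) sums
      (real (Suc k) * bessel_series (Suc k) x + x * bessel_series (Suc (Suc k)) x)"
    by (intro sums_add sums_mult s)
  moreover have "real (Suc k) * ?b (Suc k) i + c i = ?b k i" for i
  proof (cases i)
    case 0
    then show ?thesis by (simp add: c_def divide_simps)
  next
    case (Suc m)
    define a b :: real where "a = fact m" and "b = fact (Suc m + k)"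
    have ab: "(fact (Suc m + Suc k) :: real) = (real k + real m + 2) * b"
      "(fact (m + Suc (Suc k)) :: real) = (real k + real m + 2) * b"
      "(fact (Suc m) :: real) = (real m + 1) * a" "fact (Suc m + k) = b" "fact m = a"
      by (simp_all add: a_def b_def algebra_simps)
    have "a > 0" "b > 0" by (simp_all add: a_def b_def)
    hence "real (Suc k) * (1 / (((real m + 1) * a) * ((real k + real m + 2) * b)) * x ^ Suc m)
        + x * (1 / (a * ((real k + real m + 2) * b)) * x ^ m) = 1 / (((real m + 1) * a) * b) * x ^ Suc m"
      by (simp add: divide_simps) (simp add: algebra_simps)
    thus ?thesis
      by (simp only: Suc c_def ab diff_Suc_1 nat.simps if_False)
  qed
  ultimately show ?thesis
    using s[of k] sums_unique2 by simp
qed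

text \<open>Crude, since (i + k)! is only bounded below by k!, but the resulting factor 1/k! already
  beats every polynomial weight in \<open>k\<close>.\<close>

lemma bessel_series_le:
  assumes "0 \<le> x" shows "bessel_series k x \<le> exp x / fact k"
proof -
  have e: "(\<lambda>i. x ^ i /\<^sub>R fact i) sums exp x"
    using exp_converges by blast
  have "bessel_series k x \<le> (\<Sum>i. x ^ i /\<^sub>R fact i / fact k)"
    unfolding bessel_series_def
  proof (intro suminf_le summable_bessel_series)
    fix i
    have "(fact k :: real) \<le> fact (i + k)" by (intro fact_mono) simp
    hence "x ^ i / (fact i * fact (i + k)) \<le> x ^ i / (fact i * fact k)"
      using assms by (intro divide_left_mono mult_left_mono) auto
    thus "1 / (fact i * fact (i + k)) * x ^ i \<le> x ^ i /\<^sub>R fact i / fact k"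
      by (simp add: divide_inverse mult_ac)
  next
    show "summable (\<lambda>i. x ^ i /\<^sub>R fact i / fact k)"
      using e by (intro summable_divide) (auto simp: sums_iff)
  qed
  also have "\<dots> = exp x / fact k"
    using sums_divide[OF e, of "fact k"] by (simp add: sums_iff)
  finally show ?thesis .
qed

text \<open>The law exp(-2T) I_|k|(2T) of the simple walk that jumps at rate 1 in each
  direction.\<close>

definition walk_kernel :: "real \<Rightarrow> int \<Rightarrow> real" where
  "walk_kernel T k = exp (- 2 * T) * T ^ nat \<bar>k\<bar> * bessel_series (nat \<bar>k\<bar>) (T\<^sup>2)"

lemma walk_kernel_nonneg: "0 \<le> T \<Longrightarrow> 0 \<le> walk_kernel T k"
  by (simp add: walk_kernel_def bessel_series_nonneg)

lemma walk_kernel_minus: "walk_kernel T (- k) = walk_kernel T k"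
  by (simp add: walk_kernel_def)

lemma walk_kernel_0: "walk_kernel 0 k = (if k = 0 then 1 else 0)"
proof -
  have "bessel_series 0 0 = 1"
    unfolding bessel_series_def by (subst powser_zero) simp
  thus ?thesis by (simp add: walk_kernel_def)
qed

lemma walk_kernel_nat:
  "walk_kernel T (int k) = exp (- 2 * T) * (T ^ k * bessel_series k (T\<^sup>2))"
  by (simp add: walk_kernel_def)

text \<open>The Bessel identity 2k I_k(z) = z (I_(k-1)(z) - I_(k+1)(z)) at z = 2T; negative sites
  follow by reflection.\<close>

lemma walk_kernel_recurrence:
  "of_int k * walk_kernel T k = T * (walk_kernel T (k - 1) - walk_kernel T (k + 1))"
proof -
  have *: "real k * walk_kernel T (int k) = T * (walk_kernel T (int k - 1) - walk_kernel T (int k + 1))"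
    for k
  proof (cases k)
    case 0
    then show ?thesis using walk_kernel_minus[of T 1] by simp
  next
    case (Suc m)
    have e: "int (Suc m) - 1 = int m" "int (Suc m) + 1 = int (Suc (Suc m))" by simp_all
    show ?thesis
      unfolding Suc e walk_kernel_nat bessel_series_recurrence[of m]
      by (simp add: algebra_simps power2_eq_square)
  qed
  show ?thesis
  proof (cases "k \<ge> 0")
    case True
    then show ?thesis using *[of "nat k"] by simp
  next
    case False
    then show ?thesis
      using *[of "nat (- k)"] walk_kernel_minus[of T k] walk_kernel_minus[of T "- k - 1"]
        walk_kernel_minus[of T "k - 1"] by (simp add: algebra_simps)
  qed
qed

text \<open>Write B_k for the series at T^2. The chain rule gives k T^(k-1) B_k + 2 T^(k+1) B_(k+1),
  and k B_k = B_(k-1) - T^2 B_(k+1) leaves each neighbour with weight one. The exponential factor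
  supplies the remaining term.\<close>

lemma walk_kernel_deriv:
  "((\<lambda>T. walk_kernel T k) has_real_derivative
     (walk_kernel T (k + 1) + walk_kernel T (k - 1) - 2 * walk_kernel T k)) (at T)"
proof -
  have *: "((\<lambda>T. walk_kernel T (int k)) has_real_derivative
     (walk_kernel T (int k + 1) + walk_kernel T (int k - 1) - 2 * walk_kernel T (int k))) (at T)" for k
  proof -
    have D: "((\<lambda>T. walk_kernel T (int k)) has_real_derivative
      exp (- 2 * T) * (real k * T ^ (k - 1) * bessel_series k (T\<^sup>2)
         + T ^ k * (bessel_series (Suc k) (T\<^sup>2) * (2 * T)))
         - 2 * walk_kernel T (int k)) (at T)"
      unfolding walk_kernel_nat
      by (rule derivative_eq_intros DERIV_chain2[OF bessel_series_deriv] refl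
          | simp add: algebra_simps)+
    show ?thesis
    proof (cases k)
      case 0
      have "walk_kernel T 1 = walk_kernel T (int 1)" by simp
      then show ?thesis
        using D 0 walk_kernel_minus[of T 1] unfolding walk_kernel_nat
        by (simp add: algebra_simps)
    next
      case (Suc m)
      have e: "int (Suc m) - 1 = int m" "int (Suc m) + 1 = int (Suc (Suc m))" by simp_all
      have "exp (- 2 * T) * (real k * T ^ (k - 1) * bessel_series k (T\<^sup>2)
         + T ^ k * (bessel_series (Suc k) (T\<^sup>2) * (2 * T)))
        = walk_kernel T (int k + 1) + walk_kernel T (int k - 1)"
        unfolding Suc e walk_kernel_nat bessel_series_recurrence[of m]
        by (simp add: algebra_simps power2_eq_square)
      then show ?thesis using D by simp
    qed
  qed
  show ?thesis
  proof (cases "k \<ge> 0")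
    case True
    then show ?thesis using *[of "nat k"] by simp
  next
    case False
    have "walk_kernel S (int (nat (- k))) = walk_kernel S k" for S
      using False walk_kernel_minus[of S k] by simp
    then show ?thesis
      using *[of "nat (- k)"] False walk_kernel_minus[of T "- k - 1"]
        walk_kernel_minus[of T "k - 1"] by (simp add: algebra_simps)
  qed
qed

section \<open>Decay of the kernel and its maximum at the origin\<close>

lemma walk_kernel_le:
  assumes "0 \<le> T" "T \<le> T'"
  shows "walk_kernel T (int k) \<le> exp (T'\<^sup>2) * (T' ^ k / fact k)"
proof -
  have "exp (- 2 * T) * (T ^ k * bessel_series k (T\<^sup>2)) \<le> 1 * (T' ^ k * (exp (T'\<^sup>2) / fact k))"
  proof (intro mult_mono)
    have "bessel_series k (T\<^sup>2) \<le> exp (T\<^sup>2) / fact k" by (intro bessel_series_le) simp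
    also have "\<dots> \<le> exp (T'\<^sup>2) / fact k"
      using assms by (intro divide_right_mono) (auto simp: power_mono)
    finally show "bessel_series k (T\<^sup>2) \<le> exp (T'\<^sup>2) / fact k" .
  qed (use assms in \<open>auto simp: power_mono bessel_series_nonneg\<close>)
  thus ?thesis by (simp add: walk_kernel_nat mult_ac)
qed

lemma walk_kernel_2_le: "0 \<le> T \<Longrightarrow> walk_kernel T 2 \<le> walk_kernel T 0"
  using walk_kernel_recurrence[of 1 T] walk_kernel_nonneg[of T 1]
  by (cases "T = 0") (auto simp: walk_kernel_0 zero_le_mult_iff)

text \<open>The link between the parity classes comes from the heat equation: d = p(0) - p(1)
  satisfies d' = -4 d + (p(0) - p(2)), so exp(4T) d is nondecreasing and starts at 1.\<close>

lemma walk_kernel_1_le: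
  assumes "0 \<le> T" shows "walk_kernel T 1 \<le> walk_kernel T 0"
proof -
  let ?d = "\<lambda>T. exp (4 * T) * (walk_kernel T 0 - walk_kernel T 1)"
  have "?d 0 \<le> ?d T"
  proof (rule DERIV_nonneg_imp_nondecreasing[OF assms])
    fix s :: real assume s: "0 \<le> s"
    have "(?d has_real_derivative exp (4 * s) * (walk_kernel s 0 - walk_kernel s 2)) (at s)"
      using walk_kernel_minus[of s 1]
      by (auto intro!: derivative_eq_intros walk_kernel_deriv simp: algebra_simps)
    thus "\<exists>y. (?d has_real_derivative y) (at s) \<and> y \<ge> 0"
      using walk_kernel_2_le[OF s] by (intro exI conjI) auto
  qed
  thus ?thesis by (simp add: walk_kernel_0 zero_le_mult_iff)
      (smt (verit) exp_gt_zero mult_neg_pos mult_pos_neg zero_le_mult_iff)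
qed

text \<open>Induction in steps of two, the reach of the recurrence, from the sites 0 and 1.\<close>

lemma walk_kernel_le_0:
  assumes "0 < T" shows "walk_kernel T k \<le> walk_kernel T 0"
proof -
  have "walk_kernel T (int k) \<le> walk_kernel T 0" for k
  proof (induction k rule: induct_nat_012)
    case (ge2 k)
    have "0 \<le> real (Suc k) * walk_kernel T (int (Suc k))"
      using assms by (simp add: walk_kernel_nonneg)
    hence "0 \<le> T * (walk_kernel T (int k) - walk_kernel T (int (Suc (Suc k))))"
      using walk_kernel_recurrence[of "int (Suc k)" T] by (simp add: add.commute)
    then show ?case using assms ge2.IH by (simp add: zero_le_mult_iff)
  qed (use walk_kernel_1_le assms in auto)
  from this[of "nat \<bar>k\<bar>"] show ?thesis by (simp add: walk_kernel_def)
qed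

section \<open>Moments of the kernel\<close>

lemma filterlim_symmetric_int_intervals:
  "filterlim (\<lambda>K. {-int K..int K}) (finite_subsets_at_top UNIV) sequentially"
  unfolding filterlim_finite_subsets_at_top
proof (intro allI impI)
  fix X :: "int set" assume "finite X \<and> X \<subseteq> UNIV"
  hence X: "finite X" by simp
  show "\<forall>\<^sub>F K in sequentially. finite {-int K..int K} \<and> X \<subseteq> {-int K..int K}
      \<and> {-int K..int K} \<subseteq> UNIV"
    using eventually_ge_at_top[of "nat (\<Sum>k\<in>X. \<bar>k\<bar>)"]
  proof eventually_elim
    case (elim K)
    have "\<bar>k\<bar> \<le> (\<Sum>k\<in>X. \<bar>k\<bar>)" if "k \<in> X" for k
      using that X by (intro member_le_sum) auto
    with elim show ?case by fastforce
  qed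
qed

text \<open>Nonnegativity bounds every finite partial sum by \<open>s\<close>, which gives
  unconditional summability; the value is then read off along the intervals. This leads from
  telescoping sums to \<open>has_sum\<close>, where termwise comparison is available.\<close>

lemma has_sum_int_symmetric:
  fixes f :: "int \<Rightarrow> real"
  assumes nonneg: "\<And>k. 0 \<le> f k" and lim: "(\<lambda>K. \<Sum>k=-int K..int K. f k) \<longlonglongrightarrow> s"
  shows "(f has_sum s) UNIV"
proof -
  let ?I = "\<lambda>K. {-int K..int K}"
  have mono: "incseq (\<lambda>K. sum f (?I K))"
    by (intro monoI sum_mono2) (auto simp: nonneg)
  have "sum f F \<le> s" if "finite F" for F
  proof -
    have "\<forall>\<^sub>F K in sequentially. F \<subseteq> ?I K"
      using filterlim_symmetric_int_intervals that
      by (auto simp: filterlim_finite_subsets_at_top)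
    then obtain K where "F \<subseteq> ?I K"
      by (auto simp: eventually_sequentially)
    hence "sum f F \<le> sum f (?I K)" by (intro sum_mono2) (auto simp: nonneg)
    also have "\<dots> \<le> s" by (rule incseq_le[OF mono lim])
    finally show ?thesis .
  qed
  hence "f summable_on UNIV"
    by (intro nonneg_bdd_above_summable_on) (auto simp: nonneg intro!: bdd_aboveI)
  hence sum: "(f has_sum infsum f UNIV) UNIV" by simp
  hence "(sum f \<longlongrightarrow> infsum f UNIV) (finite_subsets_at_top UNIV)"
    by (simp add: has_sum_def)
  from filterlim_compose[OF this filterlim_symmetric_int_intervals] have "infsum f UNIV = s"
    using lim LIMSEQ_unique by blast
  with sum show ?thesis by simp
qed

lemma sum_symmetric_Suc:
  fixes f :: "int \<Rightarrow> 'a::comm_monoid_add"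
  shows "(\<Sum>k=-int (Suc K)..int (Suc K). f k) =
    f (- int K - 1) + f (int K + 1) + (\<Sum>k=-int K..int K. f k)"
proof -
  have "{-int (Suc K)..int (Suc K)} = insert (- int K - 1) (insert (int K + 1) {-int K..int K})"
    by auto
  thus ?thesis by (simp add: add.assoc)
qed

text \<open>A majorant of the kernel valid at all times in [0, T], so that it also controls time
  derivatives.\<close>

definition kernel_bound :: "real \<Rightarrow> nat \<Rightarrow> real" where
  "kernel_bound T k = exp (T\<^sup>2) * (T ^ k / fact k)"

lemma kernel_bound_moment_tendsto:
  assumes "0 \<le> T"
  shows "(\<lambda>k. (real k + 1) ^ 3 * kernel_bound T k) \<longlonglongrightarrow> 0"
proof -
  \<comment> \<open>Writing T^k = (2T)^k / 2^k, the power of 2 absorbs the cubic weight and the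
    factorial absorbs the rest.\<close>
  have "(\<lambda>k. (real k + 1) ^ 3 / 2 ^ k) \<longlonglongrightarrow> 0" by real_asymp
  moreover have "(\<lambda>k. (2 * T) ^ k /\<^sub>R fact k) \<longlonglongrightarrow> 0"
    by (rule summable_LIMSEQ_zero[OF summable_exp_generic])
  ultimately have "(\<lambda>k. exp (T\<^sup>2) * ((real k + 1) ^ 3 / 2 ^ k * ((2 * T) ^ k /\<^sub>R fact k))) \<longlonglongrightarrow> exp (T\<^sup>2) * (0 * 0)"
    by (intro tendsto_intros)
  moreover have "exp (T\<^sup>2) * ((real k + 1) ^ 3 / 2 ^ k * ((2 * T) ^ k /\<^sub>R fact k))
      = (real k + 1) ^ 3 * kernel_bound T k" for k
    by (simp add: kernel_bound_def power_mult_distrib field_simps)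
  ultimately show ?thesis by (simp only: mult_zero_right)
qed

text \<open>Abel summation. As \<open>\<phi>\<close> is odd and the kernel even, both ends
  contribute the same boundary term, hence the factor 2.\<close>

lemma sum_walk_kernel_by_parts:
  fixes \<phi> :: "int \<Rightarrow> real"
  assumes "\<And>k. \<phi> (- k) = - \<phi> k"
  shows "(\<Sum>k=-int K..int K. \<phi> k * (walk_kernel T (k - 1) - walk_kernel T (k + 1))) =
    (\<Sum>k=-int K..int K. (\<phi> (k + 1) - \<phi> (k - 1)) * walk_kernel T k)
    - 2 * (\<phi> (int K + 1) * walk_kernel T (int K) + \<phi> (int K) * walk_kernel T (int K + 1))"
proof (induction K)
  case 0
  have "\<phi> 0 = 0" using assms[of 0] by simp
  then show ?case using assms[of 1] by simp
next
  case (Suc K)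
  have m: "walk_kernel T (- int K) = walk_kernel T (int K)"
    "walk_kernel T (- int K - 1) = walk_kernel T (int K + 1)"
    "walk_kernel T (- int K - 2) = walk_kernel T (int K + 2)"
    using walk_kernel_minus[of T "int K"] walk_kernel_minus[of T "int K + 1"]
      walk_kernel_minus[of T "int K + 2"] by simp_all
  have p: "\<phi> (- int K) = - \<phi> (int K)"
    "\<phi> (- int K - 1) = - \<phi> (int K + 1)"
    "\<phi> (- int K - 2) = - \<phi> (int K + 2)"
    using assms[of "int K"] assms[of "int K + 1"] assms[of "int K + 2"] by simp_all
  have e: "int K + 1 - 1 = int K" "int K + 1 + 1 = int K + 2" "- int K - 1 + 1 = - int K"
    "- int K - 1 - 1 = - int K - 2" "int (Suc K) = int K + 1" by simp_all
  show ?case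
    unfolding sum_symmetric_Suc Suc.IH unfolding e m p by (simp add: algebra_simps)
qed

lemma walk_kernel_boundary_tendsto:
  assumes "0 \<le> T" and \<phi>: "\<And>k. \<bar>\<phi> (int k)\<bar> \<le> real k ^ 3"
  shows "(\<lambda>K. \<phi> (int K + 1) * walk_kernel T (int K) + \<phi> (int K) * walk_kernel T (int K + 1)) \<longlonglongrightarrow> 0"
proof (rule Lim_null_comparison)
  let ?b = "\<lambda>k. (real k + 1) ^ 3 * kernel_bound T k"
  show "(\<lambda>K. ?b K + ?b (Suc K)) \<longlonglongrightarrow> 0"
    using tendsto_add[OF kernel_bound_moment_tendsto[OF assms(1)]
      LIMSEQ_Suc[OF kernel_bound_moment_tendsto[OF assms(1)]]] by simp
  have k: "walk_kernel T (int k) \<le> kernel_bound T k" "0 \<le> walk_kernel T (int k)" for k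
    using walk_kernel_le[of T T k] walk_kernel_nonneg[of T "int k"] assms
    by (simp_all add: kernel_bound_def)
  have "norm (\<phi> (int K + 1) * walk_kernel T (int K) + \<phi> (int K) * walk_kernel T (int K + 1)) \<le> ?b K + ?b (Suc K)" for K
  proof -
    have "\<bar>\<phi> (int K + 1) * walk_kernel T (int K)\<bar> \<le> ?b K"
      unfolding abs_mult using \<phi>[of "Suc K"] k[of K]
      by (intro mult_mono) (auto simp: add.commute)
    moreover have "real K ^ 3 \<le> (real (Suc K) + 1) ^ 3" by (intro power_mono) auto
    hence "\<bar>\<phi> (int K) * walk_kernel T (int K + 1)\<bar> \<le> ?b (Suc K)"
      unfolding abs_mult using \<phi>[of K] k[of "Suc K"]
      by (intro mult_mono order_trans[OF \<phi>]) (auto simp: add.commute)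
    ultimately show ?thesis by simp
  qed
  thus "\<forall>\<^sub>F K in sequentially. norm (\<phi> (int K + 1) * walk_kernel T (int K)
      + \<phi> (int K) * walk_kernel T (int K + 1)) \<le> ?b K + ?b (Suc K)"
    by simp
qed

text \<open>The discrete Laplacian telescopes; only the flux through the two ends remains, equal on
  both sides by symmetry.\<close>

lemma walk_kernel_partial_sum_deriv:
  "((\<lambda>T. \<Sum>k=-int K..int K. walk_kernel T k) has_real_derivative
     2 * (walk_kernel T (int K + 1) - walk_kernel T (int K))) (at T)"
proof (induction K)
  case 0
  show ?case using walk_kernel_deriv[of 0 T] walk_kernel_minus[of T 1] by simp
next
  case (Suc K)
  have m: "walk_kernel T (- int K) = walk_kernel T (int K)"
    "walk_kernel T (- int K - 1) = walk_kernel T (int K + 1)"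
    "walk_kernel T (- int K - 2) = walk_kernel T (int K + 2)"
    using walk_kernel_minus[of T "int K"] walk_kernel_minus[of T "int K + 1"]
      walk_kernel_minus[of T "int K + 2"] by simp_all
  have e: "int K + 1 - 1 = int K" "int K + 1 + 1 = int K + 2" "- int K - 1 + 1 = - int K"
    "- int K - 1 - 1 = - int K - 2" "int (Suc K) = int K + 1" by simp_all
  have "((\<lambda>T. walk_kernel T (- int K - 1) + walk_kernel T (int K + 1)
      + (\<Sum>k=-int K..int K. walk_kernel T k)) has_real_derivative
     2 * (walk_kernel T (int K + 2) - walk_kernel T (int K + 1))) (at T)"
    by (rule derivative_eq_intros walk_kernel_deriv Suc.IH refl)+
      (simp add: e m)
  thus ?case unfolding sum_symmetric_Suc by (simp add: add_ac)
qed

text \<open>Conservation of mass: a partial sum equals 1 at time 0, and its time derivative, the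
  flux through the ends, is bounded on [0, T] by a quantity that vanishes as \<open>K\<close>
  grows.\<close>

lemma walk_kernel_has_sum:
  assumes "0 \<le> T"
  shows "(walk_kernel T has_sum 1) UNIV"
proof (rule has_sum_int_symmetric)
  let ?S = "\<lambda>K T. \<Sum>k=-int K..int K. walk_kernel T k"
  let ?B = "\<lambda>K. 2 * (kernel_bound T K + kernel_bound T (Suc K)) * T"
  have dist: "norm (?S K T - 1) \<le> ?B K" for K
  proof -
    have "norm (?S K T - ?S K 0) \<le> 2 * (kernel_bound T K + kernel_bound T (Suc K)) * norm (T - 0)"
    proof (rule field_differentiable_bound[where S = "{0..T}"])
      fix s assume s: "s \<in> {0..T}"
      show "(?S K has_real_derivative
        2 * (walk_kernel s (int K + 1) - walk_kernel s (int K))) (at s within {0..T})"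
        by (rule has_field_derivative_at_within[OF walk_kernel_partial_sum_deriv])
      have "\<bar>walk_kernel s (int k)\<bar> \<le> kernel_bound T k" for k
        using walk_kernel_le[of s T k] walk_kernel_nonneg[of s "int k"] s
        by (simp add: kernel_bound_def)
      from this[of K] this[of "Suc K"]
      show "norm (2 * (walk_kernel s (int K + 1) - walk_kernel s (int K)))
          \<le> 2 * (kernel_bound T K + kernel_bound T (Suc K))"
        by (simp add: add.commute)
    qed (use assms in auto)
    moreover have "?S K 0 = 1" by (simp add: walk_kernel_0)
    ultimately show ?thesis using assms by simp
  qed
  have "kernel_bound T \<longlonglongrightarrow> 0"
  proof (rule Lim_null_comparison[OF _ kernel_bound_moment_tendsto[OF assms]])
    have "kernel_bound T k \<ge> 0" for k using assms by (simp add: kernel_bound_def)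
    moreover have "1 * kernel_bound T k \<le> (real k + 1) ^ 3 * kernel_bound T k" for k
      using \<open>kernel_bound T k \<ge> 0\<close> by (intro mult_right_mono one_le_power) auto
    ultimately show "\<forall>\<^sub>F k in sequentially. norm (kernel_bound T k)
        \<le> (real k + 1) ^ 3 * kernel_bound T k"
      by simp
  qed
  hence "?B \<longlonglongrightarrow> 2 * (0 + 0) * T" by (intro tendsto_intros LIMSEQ_Suc)
  hence lim: "?B \<longlonglongrightarrow> 0" by simp
  have "(\<lambda>K. ?S K T - 1) \<longlonglongrightarrow> 0"
    by (rule Lim_null_comparison[OF always_eventually lim]) (rule allI, rule dist)
  thus "(\<lambda>K. ?S K T) \<longlonglongrightarrow> 1" by (simp add: LIM_zero_iff)
qed (use assms walk_kernel_nonneg in auto)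

text \<open>A discrete Stein identity, E[X \<phi>(X)] = T E[\<phi>(X+1) - \<phi>(X-1)], which lowers
  the degree of a moment by two. The cubic growth bound kills the boundary terms; the sign condition
  gives the nonnegative terms that symmetric summation requires.\<close>

lemma walk_kernel_moment_by_parts:
  fixes \<phi> \<psi> :: "int \<Rightarrow> real"
  assumes T: "0 \<le> T" and odd: "\<And>k. \<phi> (- k) = - \<phi> k" and \<phi>: "\<And>k. \<bar>\<phi> (int k)\<bar> \<le> real k ^ 3"
    and nonneg: "\<And>k. 0 \<le> of_int k * \<phi> k"
    and sum: "((\<lambda>k. walk_kernel T k * (\<phi> (k + 1) - \<phi> (k - 1))) has_sum s) UNIV"
  shows "((\<lambda>k. walk_kernel T k * (of_int k * \<phi> k)) has_sum T * s) UNIV"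
proof (rule has_sum_int_symmetric)
  let ?g = "\<lambda>k. walk_kernel T k * (\<phi> (k + 1) - \<phi> (k - 1))"
  have "(\<lambda>K. \<Sum>k=-int K..int K. ?g k) \<longlonglongrightarrow> s"
    using filterlim_compose[OF _ filterlim_symmetric_int_intervals] sum unfolding has_sum_def by blast
  hence "(\<lambda>K. T * ((\<Sum>k=-int K..int K. ?g k)
    - 2 * (\<phi> (int K + 1) * walk_kernel T (int K) + \<phi> (int K) * walk_kernel T (int K + 1)))) \<longlonglongrightarrow> T * (s - 2 * 0)"
    by (intro tendsto_intros walk_kernel_boundary_tendsto T \<phi>)
  moreover have "T * ((\<Sum>k=-int K..int K. ?g k)
    - 2 * (\<phi> (int K + 1) * walk_kernel T (int K) + \<phi> (int K) * walk_kernel T (int K + 1)))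
    = (\<Sum>k=-int K..int K. walk_kernel T k * (of_int k * \<phi> k))" for K
  proof -
    have "(\<Sum>k=-int K..int K. ?g k)
    - 2 * (\<phi> (int K + 1) * walk_kernel T (int K) + \<phi> (int K) * walk_kernel T (int K + 1))
     = (\<Sum>k=-int K..int K. \<phi> k * (walk_kernel T (k - 1) - walk_kernel T (k + 1)))"
      by (subst sum_walk_kernel_by_parts[of \<phi>, OF odd]) (simp add: mult.commute)
    also have "T * \<dots> = (\<Sum>k=-int K..int K. \<phi> k * (T * (walk_kernel T (k - 1) - walk_kernel T (k + 1))))"
      by (simp add: sum_distrib_left mult_ac)
    finally show ?thesis by (simp add: walk_kernel_recurrence[symmetric] mult_ac)
  qed
  ultimately show "(\<lambda>K. \<Sum>k=-int K..int K. walk_kernel T k * (of_int k * \<phi> k)) \<longlonglongrightarrow> T * s"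
    by simp
qed (use T nonneg walk_kernel_nonneg in auto)

lemma walk_kernel_second_moment:
  assumes "0 \<le> T"
  shows "((\<lambda>k. walk_kernel T k * (of_int k)\<^sup>2) has_sum 2 * T) UNIV"
proof -
  have "((\<lambda>k. walk_kernel T k * 2) has_sum 1 * 2) UNIV"
    by (intro has_sum_cmult_left walk_kernel_has_sum assms)
  moreover have "real k \<le> real k ^ 3" for k
    by (cases "k = 0") (auto intro: self_le_power)
  ultimately have "((\<lambda>k. walk_kernel T k * (of_int k * of_int k)) has_sum T * 2) UNIV"
    by (intro walk_kernel_moment_by_parts) (use assms in auto)
  thus ?thesis by (simp add: power2_eq_square mult.commute)
qed

text \<open>For \<phi>(k) = k^3 the increment is 6 k^2 + 2, with mean 12 T + 2.\<close>

lemma walk_kernel_fourth_moment: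
  assumes "0 \<le> T"
  shows "((\<lambda>k. walk_kernel T k * (of_int k) ^ 4) has_sum 12 * T\<^sup>2 + 2 * T) UNIV"
proof -
  have "((\<lambda>k. walk_kernel T k * (of_int k)\<^sup>2 * 6 + walk_kernel T k * 2) has_sum 2 * T * 6 + 1 * 2) UNIV"
    by (intro has_sum_add has_sum_cmult_left walk_kernel_has_sum walk_kernel_second_moment assms)
  also have "(\<lambda>k. walk_kernel T k * (of_int k)\<^sup>2 * 6 + walk_kernel T k * 2) =
    (\<lambda>k. walk_kernel T k * ((of_int (k + 1)) ^ 3 - (of_int (k - 1)) ^ 3))"
    by (intro ext) (simp add: power2_eq_square power3_eq_cube algebra_simps)
  finally have "((\<lambda>k. walk_kernel T k * (of_int k * of_int k ^ 3)) has_sum T * (2 * T * 6 + 1 * 2)) UNIV"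
    by (intro walk_kernel_moment_by_parts) (use assms in \<open>auto simp: zero_le_mult_iff\<close>)
  thus ?thesis by (simp add: power2_eq_square power_numeral_reduce algebra_simps)
qed

lemma walk_kernel_summable: "0 \<le> T \<Longrightarrow> walk_kernel T summable_on A"
  by (rule summable_on_subset_banach[OF has_sum_imp_summable[OF walk_kernel_has_sum]]) auto

section \<open>The distribution function of the walk\<close>

definition walk_cdf :: "real \<Rightarrow> int \<Rightarrow> real" where
  "walk_cdf T k = infsum (walk_kernel T) {..k}"

lemma walk_cdf_step:
  assumes "0 \<le> T"
  shows "walk_cdf T k = walk_cdf T (k - 1) + walk_kernel T k"
proof -
  have "infsum (walk_kernel T) ({..k - 1} \<union> {k}) = walk_cdf T (k - 1) + walk_kernel T k"
    unfolding walk_cdf_def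
    by (subst infsum_Un_disjoint[OF walk_kernel_summable walk_kernel_summable]) (use assms in auto)
  moreover have "{..k - 1} \<union> {k} = {..k}" by auto
  ultimately show ?thesis by (simp only: walk_cdf_def)
qed

lemma walk_cdf_bounds:
  assumes "0 \<le> T" shows "0 \<le> walk_cdf T k" "walk_cdf T k \<le> 1"
proof -
  show "0 \<le> walk_cdf T k"
    unfolding walk_cdf_def by (intro infsum_nonneg walk_kernel_nonneg assms)
  have "walk_cdf T k \<le> infsum (walk_kernel T) UNIV"
    unfolding walk_cdf_def
    by (intro infsum_mono_neutral walk_kernel_summable) (use assms walk_kernel_nonneg in auto)
  thus "walk_cdf T k \<le> 1" using infsumI[OF walk_kernel_has_sum[OF assms]] by simp
qed

lemma walk_cdf_reflect:
  assumes "0 \<le> T" shows "walk_cdf T k + walk_cdf T (- k - 1) = 1"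
proof -
  have "uminus ` {k + 1..} = {..- k - 1}"
    by (auto intro!: image_eqI[of _ uminus "- _"])
  hence "walk_cdf T (- k - 1) = infsum (\<lambda>j. walk_kernel T (- j)) {k + 1..}"
    unfolding walk_cdf_def by (metis (no_types, lifting) infsum_reindex inj_uminus inj_on_subset
      infsum_cong comp_apply subset_UNIV)
  also have "\<dots> = infsum (walk_kernel T) {k + 1..}" by (simp add: walk_kernel_minus)
  finally have "walk_cdf T k + walk_cdf T (- k - 1) = infsum (walk_kernel T) ({..k} \<union> {k + 1..})"
    unfolding walk_cdf_def
    by (subst infsum_Un_disjoint[OF walk_kernel_summable walk_kernel_summable]) (use assms in auto)
  also have "{..k} \<union> {k + 1..} = UNIV" by auto
  finally show ?thesis using infsumI[OF walk_kernel_has_sum[OF assms]] by simp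
qed

text \<open>The recurrence relates the kernel only at sites of equal parity, so its values are compared with
  the average over both parity classes.\<close>

definition central_height :: "real \<Rightarrow> real" where
  "central_height T = (walk_kernel T 0 + walk_kernel T 1) / 2"

text \<open>By the recurrence, consecutive averages differ by (j+1) p(j+1) / (2T), which sums to an
  error of order p(0) j^2 / T. It is weakened to a linear error on purpose: summed again it stays
  quadratic in the site, so that along a parabola fourth moments suffice.\<close>

lemma walk_kernel_pair_average:
  assumes "0 < T"
  shows "\<bar>(walk_kernel T (int j) + walk_kernel T (int j + 1)) / 2 - central_height T\<bar>
    \<le> walk_kernel T 0 * (real j / sqrt T)"
proof -
  let ?s = "\<lambda>j. (walk_kernel T (int j) + walk_kernel T (int j + 1)) / 2"
  have p: "0 \<le> walk_kernel T k" "walk_kernel T k \<le> walk_kernel T 0" for k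
    using assms by (auto intro: walk_kernel_nonneg walk_kernel_le_0)
  have "\<bar>?s j - central_height T\<bar> \<le> walk_kernel T 0 * ((real j)\<^sup>2 / T)" for j
  proof (induction j)
    case 0
    then show ?case by (simp add: central_height_def)
  next
    case (Suc j)
    have "real (Suc j) * walk_kernel T (int (Suc j))
        = T * (walk_kernel T (int j) - walk_kernel T (int j + 2))"
      using walk_kernel_recurrence[of "int (Suc j)" T] by (simp add: algebra_simps)
    hence "?s j - ?s (Suc j) = real (Suc j) * walk_kernel T (int (Suc j)) / (2 * T)"
      using assms by (simp add: field_simps)
    moreover have "real (Suc j) * walk_kernel T (int (Suc j)) / (2 * T)
        \<le> real (Suc j) * walk_kernel T 0 / (2 * T)"
      using assms by (intro divide_right_mono mult_left_mono p) auto
    moreover have "0 \<le> real (Suc j) * walk_kernel T (int (Suc j)) / (2 * T)" using p assms by simp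
    ultimately have "\<bar>?s (Suc j) - central_height T\<bar>
        \<le> walk_kernel T 0 * ((real j)\<^sup>2 / T) + real (Suc j) * walk_kernel T 0 / (2 * T)"
      using Suc.IH by linarith
    also have "\<dots> = walk_kernel T 0 * (((real j)\<^sup>2 + real (Suc j) / 2) / T)"
      using assms by (simp add: field_simps)
    also have "\<dots> \<le> walk_kernel T 0 * ((real (Suc j))\<^sup>2 / T)"
      using assms by (intro mult_left_mono divide_right_mono p) (auto simp: power2_eq_square algebra_simps)
    finally show ?case .
  qed
  note 1 = this[of j]
  have 2: "\<bar>?s j - central_height T\<bar> \<le> walk_kernel T 0"
    using p[of 0] p[of 1] p[of "int j"] p[of "int j + 1"]
    unfolding central_height_def by (intro abs_leI) argo+
  \<comment> \<open>With u = j / sqrt T the two bounds are u^2 and 1, and min(u^2, 1) <= u.\<close>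
  show ?thesis
  proof (cases "real j \<le> sqrt T")
    case True
    have "(real j)\<^sup>2 / T = (real j / sqrt T)\<^sup>2" using assms by (simp add: power_divide)
    also have "\<dots> \<le> real j / sqrt T"
      using True assms power_decreasing[of 1 2 "real j / sqrt T"] by simp
    finally show ?thesis using 1 p(1)[of 0] by (meson mult_left_mono order_trans)
  next
    case False
    hence "1 \<le> real j / sqrt T" using assms by (simp add: field_simps)
    hence "walk_kernel T 0 * 1 \<le> walk_kernel T 0 * (real j / sqrt T)" by (intro mult_left_mono p)
    thus ?thesis using 2 by simp
  qed
qed

text \<open>Averaging the distribution function over adjacent sites gives a function that is odd in
  \<open>k\<close>, vanishes at 0 and has exactly the pair averages as increments, so the errors of
  the latter add up.\<close>

lemma walk_cdf_linear:
  assumes T: "0 < T"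
  shows "\<bar>(walk_cdf T k + walk_cdf T (k - 1) - 1) / 2 - of_int k * central_height T\<bar>
    \<le> walk_kernel T 0 * ((of_int k)\<^sup>2 / sqrt T)"
proof -
  let ?A = "\<lambda>k. (walk_cdf T k + walk_cdf T (k - 1) - 1) / 2"
  have *: "\<bar>?A (int k) - real k * central_height T\<bar> \<le> walk_kernel T 0 * ((real k)\<^sup>2 / sqrt T)" for k
  proof (induction k)
    case 0
    then show ?case using walk_cdf_reflect[of T 0] T by simp
  next
    case (Suc k)
    have "?A (int (Suc k)) - ?A (int k) = (walk_kernel T (int k) + walk_kernel T (int k + 1)) / 2"
      using walk_cdf_step[of T "int k"] walk_cdf_step[of T "int k + 1"] T
      by (simp add: add.commute[of 1]) argo
    note inc = this
    have "\<bar>?A (int (Suc k)) - real (Suc k) * central_height T\<bar>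
      \<le> walk_kernel T 0 * ((real k)\<^sup>2 / sqrt T) + walk_kernel T 0 * (real k / sqrt T)"
    proof -
      have "real (Suc k) * central_height T = real k * central_height T + central_height T"
        by (simp add: algebra_simps)
      with inc show ?thesis
        using Suc.IH walk_kernel_pair_average[OF T, of k] by linarith
    qed
    also have "\<dots> = walk_kernel T 0 * (((real k)\<^sup>2 + real k) / sqrt T)"
      by (simp add: add_divide_distrib ring_distribs)
    also have "\<dots> \<le> walk_kernel T 0 * ((real (Suc k))\<^sup>2 / sqrt T)"
      using T by (intro mult_left_mono divide_right_mono walk_kernel_nonneg)
        (auto simp: power2_eq_square algebra_simps)
    finally show ?case .
  qed
  show ?thesis
  proof (cases "k \<ge> 0")
    case True
    then show ?thesis using *[of "nat k"] by simp
  next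
    case False
    have "?A (- k) = - ?A k"
      using walk_cdf_reflect[of T "k"] walk_cdf_reflect[of T "k - 1"] T by simp argo
    moreover have "\<bar>?A (- k) - of_int (- k) * central_height T\<bar>
        \<le> walk_kernel T 0 * ((of_int k)\<^sup>2 / sqrt T)"
      using *[of "nat (- k)"] False by simp
    ultimately show ?thesis by (simp only: of_int_minus)
  qed
qed

text \<open>The summand 1 is the price of the lattice: half the atom at the floor and the height
  times the fractional part both lie in [0, q], so they differ by at most q. The factor 4 is 2 * 2,
  from p(0) <= 2q and k^2 <= 2 (x^2 + 1).\<close>

lemma walk_cdf_floor:
  assumes T: "0 < T"
  shows "\<bar>walk_cdf T \<lfloor>x\<rfloor> - 1 / 2 - central_height T * x\<bar>
    \<le> central_height T * (1 + 4 * (x\<^sup>2 + 1) / sqrt T)"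
proof -
  let ?q = "central_height T"
  let ?k = "\<lfloor>x\<rfloor>"
  have p: "0 \<le> walk_kernel T k" "walk_kernel T k \<le> walk_kernel T 0" for k
    using T by (auto intro: walk_kernel_nonneg walk_kernel_le_0)
  have q: "walk_kernel T 0 \<le> 2 * ?q" "0 \<le> ?q" using p[of 0] p[of 1] by (auto simp: central_height_def)
  have k: "of_int ?k \<le> x" "x \<le> of_int ?k + 1" by linarith+
  have 1: "\<bar>(walk_cdf T ?k + walk_cdf T (?k - 1) - 1) / 2 - of_int ?k * ?q\<bar> \<le> ?q * (4 * (x\<^sup>2 + 1) / sqrt T)"
  proof -
    have "\<bar>real_of_int ?k\<bar> \<le> \<bar>x\<bar> + 1" using k by linarith
    hence "(real_of_int ?k)\<^sup>2 \<le> (\<bar>x\<bar> + 1)\<^sup>2"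
      by (metis abs_ge_zero power2_abs power_mono)
    also have "\<dots> \<le> 2 * (x\<^sup>2 + 1)"
      using sum_squares_bound[of "\<bar>x\<bar>" 1] by (simp add: power2_eq_square algebra_simps)
    finally have "walk_kernel T 0 * ((of_int ?k)\<^sup>2 / sqrt T) \<le> (2 * ?q) * (2 * (x\<^sup>2 + 1) / sqrt T)"
      using T q by (intro mult_mono divide_right_mono) auto
    also have "\<dots> = ?q * (4 * (x\<^sup>2 + 1) / sqrt T)" by simp
    finally show ?thesis using walk_cdf_linear[OF T, of ?k] by linarith
  qed
  have 2: "0 \<le> ?q * (x - of_int ?k)" "?q * (x - of_int ?k) \<le> ?q * 1"
    using q k by (simp, intro mult_left_mono) linarith+
  have "walk_cdf T ?k - 1 / 2 - ?q * x = ((walk_cdf T ?k + walk_cdf T (?k - 1) - 1) / 2 - of_int ?k * ?q)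
     + (walk_kernel T ?k / 2 - ?q * (x - of_int ?k))"
    using walk_cdf_step[of T ?k] T by (simp add: right_diff_distrib mult.commute) argo
  moreover have "\<bar>walk_kernel T ?k / 2 - ?q * (x - of_int ?k)\<bar> \<le> ?q"
    using 2 p[of ?k] q by linarith
  ultimately show ?thesis using 1 unfolding distrib_left by linarith
qed

text \<open>Chebyshev with variance 2T puts at least half the mass on the 2L + 1 <= 7 sqrt T sites
  of [-L, L], each of mass at most p(0) <= 2q; thus 28 = 2 * 7 * 2. This bound allows errors not
  proportional to q to be absorbed.\<close>

lemma central_height_lower:
  assumes T: "1 \<le> T" shows "1 / (28 * sqrt T) \<le> central_height T"
proof -
  define L where "L = nat \<lceil>2 * sqrt T\<rceil>"
  have s: "1 \<le> sqrt T" using T by simp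
  have L: "2 * sqrt T \<le> real L" "real L \<le> 2 * sqrt T + 1"
    using s unfolding L_def by linarith+
  have sq: "4 * T \<le> (of_int k)\<^sup>2" if "k \<notin> {-int L..int L}" for k
  proof -
    have "2 * sqrt T \<le> \<bar>of_int k\<bar>" using that L by auto
    hence "(2 * sqrt T)\<^sup>2 \<le> \<bar>of_int k\<bar>\<^sup>2" using s by (intro power_mono) auto
    thus ?thesis using T by (simp add: power_mult_distrib)
  qed
  have "((\<lambda>k. walk_kernel T k * (of_int k)\<^sup>2 * (1 / (4 * T))
      + (if k \<in> {-int L..int L} then walk_kernel T 0 else 0)) has_sum
      2 * T * (1 / (4 * T)) + (\<Sum>k\<in>{-int L..int L}. walk_kernel T 0)) UNIV"
    using T by (intro has_sum_add has_sum_cmult_left walk_kernel_second_moment)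
      (auto intro!: has_sum_finite_neutralI[of "{-int L..int L}"])
  with walk_kernel_has_sum[of T]
  have "1 \<le> 2 * T * (1 / (4 * T)) + (\<Sum>k\<in>{-int L..int L}. walk_kernel T 0)"
  proof (rule has_sum_mono)
    fix k
    show "walk_kernel T k \<le> walk_kernel T k * (of_int k)\<^sup>2 * (1 / (4 * T))
      + (if k \<in> {-int L..int L} then walk_kernel T 0 else 0)"
    proof (cases "k \<in> {-int L..int L}")
      case True
      have "0 \<le> walk_kernel T k * (of_int k)\<^sup>2 * (1 / (4 * T))"
        using T by (simp add: walk_kernel_nonneg)
      then show ?thesis using True walk_kernel_le_0[of T k] T by simp
    next
      case False
      have "walk_kernel T k * 1 \<le> walk_kernel T k * ((of_int k)\<^sup>2 * (1 / (4 * T)))"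
        using sq[OF False] T by (intro mult_left_mono walk_kernel_nonneg) (auto simp: field_simps)
      then show ?thesis using False by (simp only: if_False)
    qed
  qed (use T in auto)
  hence "1 / 2 \<le> (2 * real L + 1) * walk_kernel T 0" using T by (simp add: algebra_simps)
  also have "\<dots> \<le> (7 * sqrt T) * walk_kernel T 0"
    using L s T by (intro mult_right_mono walk_kernel_nonneg) linarith+
  also have "\<dots> \<le> (7 * sqrt T) * (2 * central_height T)"
    using T by (intro mult_left_mono) (auto simp: central_height_def walk_kernel_nonneg)
  finally show ?thesis using s by (simp add: field_simps)
qed

section \<open>Bounded solutions of the lattice heat equation\<close>

text \<open>Iterating the integrated equation bounds the solution by \<open>B (8ct)\<^sup>N / N!\<close> for every \<open>N\<close>.\<close>

lemma lattice_heat_zero: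
  fixes u :: "int \<Rightarrow> int \<Rightarrow> real \<Rightarrow> real"
  assumes c: "0 \<le> c" and bound: "\<And>m n t. 0 \<le> t \<Longrightarrow> \<bar>u m n t\<bar> \<le> B"
    and deriv: "\<And>m n t. 0 \<le> t \<Longrightarrow> (u m n has_real_derivative
      c * (u (m + 1) n t + u (m - 1) n t + u m (n + 1) t + u m (n - 1) t - 4 * u m n t))
      (at t within {0..})"
    and init: "\<And>m n. u m n 0 = 0" and t: "0 \<le> t"
  shows "u m n t = 0"
proof -
  have le: "\<bar>u m n t\<bar> \<le> B * ((8 * c * t) ^ N / fact N)" if "0 \<le> t" for m n t N
    using that
  proof (induction N arbitrary: m n t)
    case 0
    then show ?case using bound by simp
  next
    case (Suc N)
    let ?u' = "\<lambda>s. c * (u (m + 1) n s + u (m - 1) n s + u m (n + 1) s + u m (n - 1) s - 4 * u m n s)"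
    let ?g = "\<lambda>s. B * ((8 * c * s) ^ Suc N / fact (Suc N))"
    show ?case
    proof (cases "t = 0")
      case True
      then show ?thesis using init by simp
    next
      case False
      have "norm (u m n t - u m n 0) \<le> ?g t - ?g 0"
      proof (rule differentiable_bound_general)
        show "0 < t" using False Suc.prems by simp
        show "continuous_on {0..t} (u m n)"
          by (rule continuous_on_subset[of "{0..}"], rule DERIV_continuous_on[OF deriv]) auto
        show "continuous_on {0..t} ?g" by (intro continuous_intros) auto
      next
        fix s assume s: "0 < s" "s < t"
        have "at s within {0..} = at s" using s by (intro at_within_interior) auto
        thus "(u m n has_vector_derivative ?u' s) (at s)"
          using deriv[of s m n] s by (simp add: has_real_derivative_iff_has_vector_derivative)
        have "(?g has_real_derivative B * (real (Suc N) * (8 * c * s) ^ N * (8 * c) / fact (Suc N))) (at s)"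
          by (rule DERIV_cong[OF DERIV_cmult[OF DERIV_cdivide[OF DERIV_power[OF DERIV_cmult[OF DERIV_ident]]]]])
            (simp add: mult_ac del: fact_Suc of_nat_Suc)
        also have "real (Suc N) * (8 * c * s) ^ N * (8 * c) / fact (Suc N) = 8 * c * ((8 * c * s) ^ N / fact N)"
          by (simp add: field_simps del: of_nat_Suc)
        finally show "(?g has_vector_derivative B * (8 * c * ((8 * c * s) ^ N / fact N))) (at s)"
          by (simp add: has_real_derivative_iff_has_vector_derivative)
        have b: "\<bar>u m n s\<bar> \<le> B * ((8 * c * s) ^ N / fact N)" for m n
          using Suc.IH[of s m n] s by simp
        have "\<bar>u (m + 1) n s + u (m - 1) n s + u m (n + 1) s + u m (n - 1) s - 4 * u m n s\<bar>
            \<le> 8 * (B * ((8 * c * s) ^ N / fact N))"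
          using b[of "m + 1" n] b[of "m - 1" n] b[of m "n + 1"] b[of m "n - 1"] b[of m n]
          by linarith
        hence "c * \<bar>u (m + 1) n s + u (m - 1) n s + u m (n + 1) s + u m (n - 1) s - 4 * u m n s\<bar>
            \<le> c * (8 * (B * ((8 * c * s) ^ N / fact N)))"
          by (rule mult_left_mono[OF _ c])
        thus "norm (?u' s) \<le> B * (8 * c * ((8 * c * s) ^ N / fact N))"
          using c by (simp add: abs_mult mult_ac)
      qed
      then show ?thesis using init by simp
    qed
  qed
  have "(\<lambda>N. (8 * c * t) ^ N /\<^sub>R fact N) \<longlonglongrightarrow> 0"
    by (rule summable_LIMSEQ_zero[OF summable_exp_generic])
  hence "(\<lambda>N. B * ((8 * c * t) ^ N /\<^sub>R fact N)) \<longlonglongrightarrow> B * 0" by (intro tendsto_intros)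
  hence "\<bar>u m n t\<bar> \<le> B * 0"
    by (rule LIMSEQ_le_const) (use le[OF t, of m n] in \<open>auto simp: divide_inverse mult.commute\<close>)
  thus ?thesis by simp
qed

section \<open>Representation of the bounded solution by the kernel\<close>

lemma walk_kernel_le_1: "0 \<le> T \<Longrightarrow> walk_kernel T k \<le> 1"
  using walk_cdf_step[of T k] walk_cdf_bounds[of T k] walk_cdf_bounds[of T "k - 1"] by linarith

text \<open>The product of two one-dimensional kernels at time t/h^2 solves the planar equation and
  starts as a point mass. The finite superposition over the initial set is bounded, so uniqueness
  identifies it with \<open>w\<close>.\<close>

lemma bounded_heat_solution_eq_sum:
  assumes h: "0 < h" and w: "bounded_heat_solution \<Omega> h w"
    and S: "finite {(j, k). (of_int j * h, of_int k * h) \<in> \<Omega>}" and t: "0 \<le> t"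
  shows "w m n t = (\<Sum>(j, k)\<in>{(j, k). (of_int j * h, of_int k * h) \<in> \<Omega>}.
    walk_kernel (t / h\<^sup>2) (j - m) * walk_kernel (t / h\<^sup>2) (k - n))"
proof -
  let ?S = "{(j, k). (of_int j * h, of_int k * h) \<in> \<Omega>}"
  define v where "v m n t = (\<Sum>(j, k)\<in>?S.
    walk_kernel (t / h\<^sup>2) (j - m) * walk_kernel (t / h\<^sup>2) (k - n))" for m n t
  let ?L = "\<lambda>u m n t. (1 / h\<^sup>2) * (u (m + 1) n t + u (m - 1) n t + u m (n + 1) t + u m (n - 1) t
    - 4 * u m n t :: real)"
  obtain B where B: "\<And>m n t. 0 \<le> t \<Longrightarrow> \<bar>w m n t\<bar> \<le> B"
    using w unfolding bounded_heat_solution_def by blast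
  have w': "(w m n has_real_derivative ?L w m n t) (at t within {0..})" if "0 \<le> t" for m n t
    using w that unfolding bounded_heat_solution_def by blast
  have K: "((\<lambda>t. walk_kernel (t / h\<^sup>2) k) has_real_derivative
     (walk_kernel (t / h\<^sup>2) (k + 1) + walk_kernel (t / h\<^sup>2) (k - 1) - 2 * walk_kernel (t / h\<^sup>2) k)
        * (1 / h\<^sup>2)) (at t within A)" for k t A
    by (rule DERIV_chain2[OF walk_kernel_deriv DERIV_cdivide[OF DERIV_ident]])
  have v': "(v m n has_real_derivative ?L v m n t) (at t within {0..})" for m n t
  proof -
    let ?p = "walk_kernel (t / h\<^sup>2)"
    let ?d = "\<lambda>k. (?p (k + 1) + ?p (k - 1) - 2 * ?p k) * (1 / h\<^sup>2)"
    have "(v m n has_real_derivative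
       (\<Sum>(j, k)\<in>?S. ?d (j - m) * ?p (k - n) + ?d (k - n) * ?p (j - m))) (at t within {0..})"
      unfolding v_def[abs_def] case_prod_unfold
      by (intro DERIV_sum DERIV_mult K)
    also have "(\<Sum>(j, k)\<in>?S. ?d (j - m) * ?p (k - n) + ?d (k - n) * ?p (j - m)) = ?L v m n t"
      unfolding v_def sum_distrib_left sum.distrib[symmetric] sum_subtractf[symmetric]
      by (intro sum.cong refl) (simp add: case_prod_unfold algebra_simps)
    finally show ?thesis .
  qed
  have "w m n t - v m n t = 0"
  proof (rule lattice_heat_zero[where u = "\<lambda>m n t. w m n t - v m n t"])
    show "0 \<le> 1 / h\<^sup>2" by simp
    show "0 \<le> t" by (rule t)
    show "w m n 0 - v m n 0 = 0" for m n
    proof -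
      have "v m n 0 = (\<Sum>jk\<in>?S. if jk = (m, n) then 1 else 0)"
        unfolding v_def by (intro sum.cong) (auto simp: walk_kernel_0 split: if_splits)
      also have "\<dots> = (if (m, n) \<in> ?S then 1 else 0)" using S by (simp add: sum.delta)
      finally show ?thesis using w by (simp add: bounded_heat_solution_def)
    qed
    show "((\<lambda>t. w m n t - v m n t) has_real_derivative ?L (\<lambda>m n t. w m n t - v m n t) m n t)
        (at t within {0..})" if "0 \<le> t" for m n t
      by (rule DERIV_cong[OF DERIV_diff[OF w'[OF that] v']]) (simp add: algebra_simps)
    show "\<bar>w m n t - v m n t\<bar> \<le> B + real (card ?S)" if "0 \<le> t" for m n t
    proof -
      have p: "0 \<le> walk_kernel (t / h\<^sup>2) k" "walk_kernel (t / h\<^sup>2) k \<le> 1" for k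
        using that by (auto intro: walk_kernel_nonneg walk_kernel_le_1)
      have "\<bar>v m n t\<bar> \<le> (\<Sum>(j, k)\<in>?S. 1)"
        unfolding v_def case_prod_unfold using p
        by (intro order_trans[OF sum_abs] sum_mono) (auto simp: abs_mult mult_le_one)
      also have "\<dots> = real (card ?S)" by (simp add: case_prod_unfold)
      finally show ?thesis using B[OF that, of m n] by linarith
    qed
  qed
  thus ?thesis by (simp add: v_def)
qed

lemma finite_lattice_points:
  fixes \<Omega> :: "(real \<times> real) set"
  assumes "bounded \<Omega>" "0 < h"
  shows "finite {(j, k). (of_int j * h, of_int k * h) \<in> \<Omega>}"
proof -
  obtain R where R: "\<And>p. p \<in> \<Omega> \<Longrightarrow> norm p \<le> R" using assms(1) bounded_iff by blast
  let ?I = "{-\<lceil>R / h\<rceil>..\<lceil>R / h\<rceil>}"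
  have I: "j \<in> ?I" if "\<bar>of_int j * h\<bar> \<le> R" for j :: int
  proof -
    have "\<bar>real_of_int j\<bar> \<le> R / h" using that assms(2) by (simp add: abs_mult field_simps)
    thus ?thesis by (simp, linarith)
  qed
  have "{(j, k). (of_int j * h, of_int k * h) \<in> \<Omega>} \<subseteq> ?I \<times> ?I"
  proof (clarify, intro conjI SigmaI I)
    fix j k :: int assume "(of_int j * h, of_int k * h) \<in> \<Omega>"
    note r = R[OF this]
    show "\<bar>of_int j * h\<bar> \<le> R" "\<bar>of_int k * h\<bar> \<le> R"
      using order_trans[OF norm_fst_le r] order_trans[OF norm_snd_le r] by simp_all
  qed
  thus ?thesis by (rule finite_subset) simp
qed

section \<open>Lattice sets close to a parabola\<close>

lemma walk_cdf_has_sum: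
  assumes "0 \<le> T"
  shows "((\<lambda>i. if i \<le> k then walk_kernel T i else 0) has_sum walk_cdf T k) UNIV"
proof -
  have "(walk_kernel T has_sum walk_cdf T k) {..k}"
    unfolding walk_cdf_def by (intro has_sum_infsum walk_kernel_summable assms)
  thus ?thesis by (rule has_sum_cong_neutral[THEN iffD1, rotated -1]) auto
qed

text \<open>The mean of 1 + 4 (x^2 + 1) / sqrt T, the relative error at the floor, for x = a X^2 - y
  with E X^2 = 2T and E X^4 = 12 T^2 + 2T.\<close>

definition parabola_defect :: "real \<Rightarrow> real \<Rightarrow> real \<Rightarrow> real" where
  "parabola_defect T a y = 1 + 4 * (a\<^sup>2 * (12 * T\<^sup>2 + 2 * T) - 4 * a * y * T + y\<^sup>2 + 1) / sqrt T"

text \<open>The linear approximation at the floor is averaged over X; its main term has mean 2aT -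
  y.\<close>

lemma walk_cdf_parabola:
  assumes T: "0 < T"
  obtains s where "((\<lambda>j. walk_kernel T j * walk_cdf T \<lfloor>a * (of_int j)\<^sup>2 - y\<rfloor>) has_sum s) UNIV"
    "\<bar>s - 1 / 2 - central_height T * (2 * a * T - y)\<bar> \<le> central_height T * parabola_defect T a y"
proof -
  let ?p = "walk_kernel T" and ?q = "central_height T"
  let ?x = "\<lambda>j. a * (real_of_int j)\<^sup>2 - y"
  let ?G = "\<lambda>j. walk_cdf T \<lfloor>?x j\<rfloor>"
  have p: "0 \<le> ?p j" for j using T by (simp add: walk_kernel_nonneg)
  have "(\<lambda>j. ?p j * ?G j) summable_on UNIV"
  proof (rule summable_on_comparison_test[OF walk_kernel_summable])
    fix j show "?p j * ?G j \<le> ?p j"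
      using p[of j] walk_cdf_bounds[of T "\<lfloor>?x j\<rfloor>"] T by (simp add: mult_left_le)
    show "0 \<le> ?p j * ?G j" using p[of j] walk_cdf_bounds[of T "\<lfloor>?x j\<rfloor>"] T by simp
  qed (use T in simp)
  then obtain s where s: "((\<lambda>j. ?p j * ?G j) has_sum s) UNIV" by (auto simp: summable_on_def)
  \<comment> \<open>Coefficients of the pointwise error as a polynomial in j, in degrees 0, 2 and
    4.\<close>
  let ?c0 = "?q * (1 + 4 * (y\<^sup>2 + 1) / sqrt T)" and ?c2 = "- ?q * (8 * a * y / sqrt T)"
    and ?c4 = "?q * (4 * a\<^sup>2 / sqrt T)"
  have poly: "((\<lambda>j. ?p j * d0 + ?p j * (of_int j)\<^sup>2 * d2 + ?p j * of_int j ^ 4 * d4) has_sum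
    1 * d0 + 2 * T * d2 + (12 * T\<^sup>2 + 2 * T) * d4) UNIV" for d0 d2 d4
    using T by (intro has_sum_add has_sum_cmult_left walk_kernel_has_sum walk_kernel_second_moment
      walk_kernel_fourth_moment) auto
  have G: "\<bar>?G j - 1 / 2 - ?q * ?x j\<bar> \<le> ?c0 + (of_int j)\<^sup>2 * ?c2 + of_int j ^ 4 * ?c4" for j
  proof -
    have sq: "(?x j)\<^sup>2 = a\<^sup>2 * of_int j ^ 4 - 2 * a * y * (of_int j)\<^sup>2 + y\<^sup>2"
      by (simp add: power2_eq_square power_numeral_reduce algebra_simps)
    have "?q * (1 + 4 * ((?x j)\<^sup>2 + 1) / sqrt T) = ?c0 + (of_int j)\<^sup>2 * ?c2 + of_int j ^ 4 * ?c4"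
      unfolding sq by (simp add: divide_inverse algebra_simps)
    thus ?thesis using walk_cdf_floor[OF T, of "?x j"] by simp
  qed
  have D: "?c0 + 2 * T * ?c2 + (12 * T\<^sup>2 + 2 * T) * ?c4 = ?q * parabola_defect T a y"
    by (simp add: parabola_defect_def divide_inverse algebra_simps)
  have "s \<le> 1 * (1 / 2 - ?q * y + ?c0) + 2 * T * (?q * a + ?c2) + (12 * T\<^sup>2 + 2 * T) * ?c4"
  proof (rule has_sum_mono[OF s poly])
    fix j
    have "?G j \<le> (1 / 2 - ?q * y + ?c0) + (of_int j)\<^sup>2 * (?q * a + ?c2) + of_int j ^ 4 * ?c4"
      using G[of j] by (simp add: abs_le_iff algebra_simps)
    from mult_left_mono[OF this p[of j]]
    show "?p j * ?G j \<le> ?p j * (1 / 2 - ?q * y + ?c0) + ?p j * (of_int j)\<^sup>2 * (?q * a + ?c2)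
      + ?p j * of_int j ^ 4 * ?c4" by (simp only: distrib_left mult.assoc)
  qed
  moreover have "1 * (1 / 2 - ?q * y + - ?c0) + 2 * T * (?q * a + - ?c2) + (12 * T\<^sup>2 + 2 * T) * (- ?c4) \<le> s"
  proof (rule has_sum_mono[OF poly s])
    fix j
    have "(1 / 2 - ?q * y + - ?c0) + (of_int j)\<^sup>2 * (?q * a + - ?c2) + of_int j ^ 4 * (- ?c4) \<le> ?G j"
      using G[of j] by (simp add: abs_le_iff algebra_simps)
    from mult_left_mono[OF this p[of j]]
    show "?p j * (1 / 2 - ?q * y + - ?c0) + ?p j * (of_int j)\<^sup>2 * (?q * a + - ?c2)
      + ?p j * of_int j ^ 4 * (- ?c4) \<le> ?p j * ?G j" by (simp only: distrib_left mult.assoc)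
  qed
  ultimately have "\<bar>s - 1 / 2 - ?q * (2 * a * T - y)\<bar> \<le> ?q * parabola_defect T a y"
    unfolding D[symmetric] by (simp only: abs_le_iff) (simp add: algebra_simps)
  with s that show ?thesis by blast
qed

text \<open>Chebyshev bound for leaving the chart of half-width \<open>c\<close>: 2T from the
  horizontal walk, and 4T + 2y^2 from the shifted vertical one by (i + y)^2 <= 2 i^2 + 2
  y^2.\<close>

definition far_mass :: "real \<Rightarrow> real \<Rightarrow> real \<Rightarrow> real \<Rightarrow> real" where
  "far_mass T h c y = (6 * T + 2 * y\<^sup>2) * (h\<^sup>2 / c\<^sup>2)"

text \<open>Conditioning on the horizontal coordinate compares each column of \<open>S\<close> with
  a half-line ending on the parabola; sites outside the chart are paid for by
  \<open>far_mass\<close>. The two inequalities stand apart because the set will be squeezed between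
  parabolas with different \<open>a\<close>.\<close>

lemma lattice_set_walk_measure:
  fixes S :: "(int \<times> int) set" and n :: int
  assumes T: "0 < T" and h: "0 < h" and c: "0 < c" and S: "finite S"
  defines "P \<equiv> \<Sum>(j, i)\<in>S. walk_kernel T j * walk_kernel T i"
  defines "E \<equiv> \<lambda>a. central_height T * parabola_defect T a n + far_mass T h c n"
  shows "\<lbrakk>\<And>j i. \<lbrakk>\<bar>of_int j * h\<bar> < c; \<bar>of_int (i + n) * h\<bar> < c; (j, i) \<in> S\<rbrakk> \<Longrightarrow>
        of_int (i + n) \<le> a * (of_int j)\<^sup>2\<rbrakk> \<Longrightarrow>
      P \<le> 1 / 2 + central_height T * (2 * a * T - n) + E a" (is "PROP ?above \<Longrightarrow> _")
    and "\<lbrakk>\<And>j i. \<lbrakk>\<bar>of_int j * h\<bar> < c; \<bar>of_int (i + n) * h\<bar> < c;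
        of_int (i + n) \<le> a * (of_int j)\<^sup>2\<rbrakk> \<Longrightarrow> (j, i) \<in> S\<rbrakk> \<Longrightarrow>
      1 / 2 + central_height T * (2 * a * T - n) - E a \<le> P" (is "PROP ?below \<Longrightarrow> _")
proof -
  let ?p = "walk_kernel T"
  let ?G = "\<lambda>j. walk_cdf T \<lfloor>a * (of_int j)\<^sup>2 - n\<rfloor>"
  have p: "0 \<le> ?p j" for j using T by (simp add: walk_kernel_nonneg)
  define row where "row j = sum ?p {i. (j, i) \<in> S}" for j
  have fin: "finite {i. (j, i) \<in> S}" for j
    using finite_imageI[OF S, of snd] by (rule rev_finite_subset) force
  have row: "((\<lambda>i. if (j, i) \<in> S then ?p i else 0) has_sum row j) UNIV" for j
    unfolding row_def using fin[of j]
    by (intro has_sum_finite_neutralI[of "{i. (j, i) \<in> S}"]) auto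
  have row01: "0 \<le> row j" "row j \<le> 1" for j
    using has_sum_mono[OF row walk_kernel_has_sum[of T]] T p
    by (auto simp: row_def intro: sum_nonneg)
  have P: "((\<lambda>j. ?p j * row j) has_sum P) UNIV"
  proof -
    have "S = (SIGMA j:fst ` S. {i. (j, i) \<in> S})" by force
    hence "P = (\<Sum>j\<in>fst ` S. \<Sum>i\<in>{i. (j, i) \<in> S}. ?p j * ?p i)"
      unfolding P_def using S fin by (metis (no_types, lifting) sum.Sigma finite_imageI sum.cong)
    also have "\<dots> = (\<Sum>j\<in>fst ` S. ?p j * row j)" by (simp add: row_def sum_distrib_left)
    finally have "P = (\<Sum>j\<in>fst ` S. ?p j * row j)" .
    moreover have "row j = 0" if "j \<notin> fst ` S" for j
    proof -
      have "{i. (j, i) \<in> S} = {}" using that by force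
      thus ?thesis by (simp add: row_def)
    qed
    ultimately show ?thesis using S
      by (intro has_sum_finite_neutralI[of "fst ` S"]) auto
  qed
  define r where "r = h\<^sup>2 / c\<^sup>2"
  have r: "0 \<le> r" by (simp add: r_def)
  have far: "1 \<le> (of_int k)\<^sup>2 * r" if "\<not> \<bar>of_int k * h\<bar> < c" for k
  proof -
    have "c\<^sup>2 \<le> (of_int k * h)\<^sup>2" using that c by (metis abs_le_square_iff abs_of_pos not_less)
    thus ?thesis using c by (simp add: r_def power_mult_distrib)
  qed
  have far_i: "1 \<le> ((of_int i)\<^sup>2 * 2 + 2 * (of_int n)\<^sup>2) * r" if "\<not> \<bar>of_int (i + n) * h\<bar> < c" for i
  proof -
    have "(real_of_int (i + n))\<^sup>2 \<le> (of_int i)\<^sup>2 * 2 + 2 * (of_int n)\<^sup>2"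
      using sum_squares_bound[of "real_of_int i" "of_int n"] by (simp add: power2_eq_square algebra_simps)
    hence "(real_of_int (i + n))\<^sup>2 * r \<le> ((of_int i)\<^sup>2 * 2 + 2 * (of_int n)\<^sup>2) * r"
      using r by (rule mult_right_mono)
    thus ?thesis using far[OF that] by simp
  qed
  \<comment> \<open>A summable weight that dominates the kernel wherever \<open>i + n\<close> leaves
    the chart and is nonnegative elsewhere.\<close>
  let ?t = "\<lambda>i. ?p i * (of_int i)\<^sup>2 * (2 * r) + ?p i * (2 * (of_int n)\<^sup>2 * r)"
  have tail: "(?t has_sum 2 * T * (2 * r) + 1 * (2 * (of_int n)\<^sup>2 * r)) UNIV"
    using T by (intro has_sum_add has_sum_cmult_left walk_kernel_has_sum walk_kernel_second_moment) auto
  define \<tau> where "\<tau> = 2 * T * (2 * r) + 1 * (2 * (of_int n)\<^sup>2 * r)"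
  have t: "0 \<le> ?t i" for i using p r by simp
  have t_far: "?p i \<le> ?t i" if "\<not> \<bar>of_int (i + n) * h\<bar> < c" for i
    using mult_left_mono[OF far_i[OF that] p[of i]] by (simp add: algebra_simps)
  have \<tau>: "0 \<le> \<tau>" using T r by (simp add: \<tau>_def)
  have floor_iff: "i \<le> \<lfloor>a * (of_int j)\<^sup>2 - n\<rfloor> \<longleftrightarrow> of_int (i + n) \<le> a * (of_int j)\<^sup>2" for i j
    by (simp add: le_floor_iff le_diff_eq)
  obtain s where s: "((\<lambda>j. ?p j * ?G j) has_sum s) UNIV" and
    s': "\<bar>s - 1 / 2 - central_height T * (2 * a * T - n)\<bar> \<le> central_height T * parabola_defect T a n"
    using walk_cdf_parabola[OF T] .
  have extra: "((\<lambda>j. ?p j * \<tau> + ?p j * (of_int j)\<^sup>2 * r) has_sum 1 * \<tau> + 2 * T * r) UNIV"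
    using T by (intro has_sum_add has_sum_cmult_left walk_kernel_has_sum walk_kernel_second_moment) auto
  have far_mass: "1 * \<tau> + 2 * T * r = far_mass T h c n"
    by (simp add: \<tau>_def far_mass_def r_def[symmetric] algebra_simps)
  {
    assume above: "PROP ?above"
    \<comment> \<open>In a near column only vertical exits cost, at most \<open>\<tau>\<close> in
      total; in a far column the trivial bound 1 is at most j^2 r.\<close>
    have "row j \<le> ?G j + (\<tau> + (of_int j)\<^sup>2 * r)" for j
    proof (cases "\<bar>of_int j * h\<bar> < c")
      case True
      have "row j \<le> ?G j + \<tau>" unfolding \<tau>_def
      proof (rule has_sum_mono[OF row has_sum_add[OF walk_cdf_has_sum tail]])
        show "0 \<le> T" using T by simp
        fix i
        show "(if (j, i) \<in> S then ?p i else 0) \<le>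
          (if i \<le> \<lfloor>a * (of_int j)\<^sup>2 - n\<rfloor> then ?p i else 0) + ?t i"
          unfolding floor_iff using above[OF True, of i] t[of i] t_far[of i] p[of i]
          by (cases "\<bar>of_int (i + n) * h\<bar> < c") auto
      qed
      moreover have "0 \<le> (of_int j)\<^sup>2 * r" using r by simp
      ultimately show ?thesis by linarith
    next
      case False
      then show ?thesis
        using far[OF False] row01[of j] \<tau> walk_cdf_bounds[of T "\<lfloor>a * (of_int j)\<^sup>2 - n\<rfloor>"] T by linarith
    qed
    hence "?p j * row j \<le> ?p j * ?G j + (?p j * \<tau> + ?p j * (of_int j)\<^sup>2 * r)" for j
      using mult_left_mono[OF _ p[of j]] by (fastforce simp: distrib_left mult.assoc)
    hence "P \<le> s + (1 * \<tau> + 2 * T * r)"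
      by (intro has_sum_mono[OF P has_sum_add[OF s extra]]) auto
    thus "P \<le> 1 / 2 + central_height T * (2 * a * T - n) + E a"
      using s' unfolding far_mass E_def by linarith
  }
  {
    assume below: "PROP ?below"
    have "?G j \<le> row j + (\<tau> + (of_int j)\<^sup>2 * r)" for j
    proof (cases "\<bar>of_int j * h\<bar> < c")
      case True
      have "?G j \<le> row j + \<tau>" unfolding \<tau>_def
      proof (rule has_sum_mono[OF walk_cdf_has_sum has_sum_add[OF row tail]])
        show "0 \<le> T" using T by simp
        fix i
        show "(if i \<le> \<lfloor>a * (of_int j)\<^sup>2 - n\<rfloor> then ?p i else 0)
          \<le> (if (j, i) \<in> S then ?p i else 0) + ?t i"
          unfolding floor_iff using below[OF True, of i] t[of i] t_far[of i] p[of i]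
          by (cases "\<bar>of_int (i + n) * h\<bar> < c") auto
      qed
      moreover have "0 \<le> (of_int j)\<^sup>2 * r" using r by simp
      ultimately show ?thesis by linarith
    next
      case False
      then show ?thesis
        using far[OF False] row01[of j] \<tau> walk_cdf_bounds[of T "\<lfloor>a * (of_int j)\<^sup>2 - n\<rfloor>"] T by linarith
    qed
    hence "?p j * ?G j \<le> ?p j * row j + (?p j * \<tau> + ?p j * (of_int j)\<^sup>2 * r)" for j
      using mult_left_mono[OF _ p[of j]] by (fastforce simp: distrib_left mult.assoc)
    hence "s \<le> P + (1 * \<tau> + 2 * T * r)"
      by (intro has_sum_mono[OF s has_sum_add[OF P extra]]) auto
    thus "1 / 2 + central_height T * (2 * a * T - n) - E a \<le> P"
      using s' unfolding far_mass E_def by linarith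
  }
qed

section \<open>The discrete normal velocity\<close>

text \<open>The derivative of f' at 0 gives |f'(y) - b y| <= \<epsilon>/2 |y| near 0; the mean value
  inequality on [-|x|, |x|] integrates it.\<close>

lemma quadratic_expansion:
  fixes f f' :: "real \<Rightarrow> real"
  assumes c\<^sub>0: "0 < c\<^sub>0" and f: "\<forall>x\<in>{-c\<^sub>0<..<c\<^sub>0}. (f has_real_derivative f' x) (at x)"
    and f': "(f' has_real_derivative b) (at 0)" and zero: "f 0 = 0" "f' 0 = 0" and \<epsilon>: "0 < \<epsilon>"
  obtains c where "0 < c" "c \<le> c\<^sub>0" "\<And>x. \<bar>x\<bar> < c \<Longrightarrow> \<bar>f x - b / 2 * x\<^sup>2\<bar> \<le> \<epsilon> / 2 * x\<^sup>2"
proof -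
  have "(\<lambda>h. (f' (0 + h) - f' 0) / h) \<midarrow>0\<rightarrow> b" using f' unfolding DERIV_def .
  from LIM_D[OF this, of "\<epsilon> / 2"] obtain d where d: "0 < d"
    "\<And>x. x \<noteq> 0 \<Longrightarrow> \<bar>x\<bar> < d \<Longrightarrow> \<bar>f' x / x - b\<bar> < \<epsilon> / 2"
    using \<epsilon> zero by auto
  have f'_le: "\<bar>f' x - b * x\<bar> \<le> \<epsilon> / 2 * \<bar>x\<bar>" if "\<bar>x\<bar> < d" for x
  proof (cases "x = 0")
    case False
    have "\<bar>f' x - b * x\<bar> = \<bar>f' x / x - b\<bar> * \<bar>x\<bar>"
      using False by (simp add: abs_mult[symmetric] field_simps)
    also have "\<dots> \<le> \<epsilon> / 2 * \<bar>x\<bar>" using d(2)[OF False that] by (intro mult_right_mono) auto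
    finally show ?thesis .
  qed (use zero in simp)
  show thesis
  proof (rule that[of "min d c\<^sub>0"])
    fix x assume x: "\<bar>x\<bar> < min d c\<^sub>0"
    let ?I = "{-\<bar>x\<bar>..\<bar>x\<bar>}"
    have "norm ((f x - b / 2 * x\<^sup>2) - (f 0 - b / 2 * 0\<^sup>2)) \<le> \<epsilon> / 2 * \<bar>x\<bar> * norm (x - 0)"
    proof (rule field_differentiable_bound[where S = ?I and f = "\<lambda>x. f x - b / 2 * x\<^sup>2"])
      fix y assume y: "y \<in> ?I"
      have "(f has_real_derivative f' y) (at y within ?I)"
        using x y by (intro has_field_derivative_at_within[OF f[rule_format]]) auto
      thus "((\<lambda>x. f x - b / 2 * x\<^sup>2) has_real_derivative f' y - b * y) (at y within ?I)"
        by (auto intro!: derivative_eq_intros)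
      have "\<bar>f' y - b * y\<bar> \<le> \<epsilon> / 2 * \<bar>y\<bar>" using x y by (intro f'_le) auto
      also have "\<dots> \<le> \<epsilon> / 2 * \<bar>x\<bar>" using y \<epsilon> by (intro mult_left_mono) auto
      finally show "norm (f' y - b * y) \<le> \<epsilon> / 2 * \<bar>x\<bar>" by simp
    qed auto
    thus "\<bar>f x - b / 2 * x\<^sup>2\<bar> \<le> \<epsilon> / 2 * x\<^sup>2" by (simp add: zero power2_eq_square mult.assoc)
  qed (use d c\<^sub>0 in auto)
qed

text \<open>The total error in units of the central height: \<open>far_mass\<close> is divided by
  the lower bound 1 / (28 sqrt T).\<close>

definition relative_defect :: "real \<Rightarrow> real \<Rightarrow> real \<Rightarrow> real \<Rightarrow> real \<Rightarrow> real" where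
  "relative_defect \<mu> b c y h = parabola_defect (\<mu> / h) (b * h / 2) y
     + 28 * sqrt (\<mu> / h) * far_mass (\<mu> / h) h c y"

text \<open>With a T = b \<mu> / 2 free of h and 1 / sqrt T = sqrt(h/\<mu>), everything but the
  rounding term is O(sqrt h). The limit depends on none of the parameters, which is what makes the
  final estimate uniform in \<mu>.\<close>

lemma relative_defect_tendsto:
  assumes \<mu>: "0 < \<mu>" and c: "0 < c"
  shows "(relative_defect \<mu> b c y \<longlongrightarrow> 1) (at_right 0)"
proof -
  have "((\<lambda>h. 1 + 4 * (3 * b\<^sup>2 * \<mu>\<^sup>2 + b\<^sup>2 * \<mu> * h / 2 - 2 * b * y * \<mu> + y\<^sup>2 + 1) * (sqrt h / sqrt \<mu>)
      + 28 * sqrt \<mu> * (6 * \<mu> * sqrt h + 2 * y\<^sup>2 * (h * sqrt h)) / c\<^sup>2) \<longlongrightarrow>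
      1 + 4 * (3 * b\<^sup>2 * \<mu>\<^sup>2 + b\<^sup>2 * \<mu> * 0 / 2 - 2 * b * y * \<mu> + y\<^sup>2 + 1) * (sqrt 0 / sqrt \<mu>)
      + 28 * sqrt \<mu> * (6 * \<mu> * sqrt 0 + 2 * y\<^sup>2 * (0 * sqrt 0)) / c\<^sup>2) (at_right 0)"
    by (intro tendsto_intros) (use \<mu> c in auto)
  moreover have "\<forall>\<^sub>F h in at_right 0.
      1 + 4 * (3 * b\<^sup>2 * \<mu>\<^sup>2 + b\<^sup>2 * \<mu> * h / 2 - 2 * b * y * \<mu> + y\<^sup>2 + 1) * (sqrt h / sqrt \<mu>)
      + 28 * sqrt \<mu> * (6 * \<mu> * sqrt h + 2 * y\<^sup>2 * (h * sqrt h)) / c\<^sup>2 = relative_defect \<mu> b c y h"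
    using eventually_at_right_less[of 0]
  proof eventually_elim
    case (elim h)
    have "(b * h / 2)\<^sup>2 * (12 * (\<mu> / h)\<^sup>2 + 2 * (\<mu> / h)) = 3 * b\<^sup>2 * \<mu>\<^sup>2 + b\<^sup>2 * \<mu> * h / 2"
      using elim by (simp add: power2_eq_square field_simps)
    moreover have "4 * (b * h / 2) * y * (\<mu> / h) = 2 * b * y * \<mu>" using elim by simp
    moreover have "sqrt (\<mu> / h) * ((6 * (\<mu> / h) + 2 * y\<^sup>2) * (h\<^sup>2 / c\<^sup>2))
      = sqrt \<mu> * (6 * \<mu> * sqrt h + 2 * y\<^sup>2 * (h * sqrt h)) / c\<^sup>2"
    proof -
      have "sqrt (\<mu> / h) * h = sqrt \<mu> * sqrt h"
        using elim real_sqrt_mult_self[of h] by (simp add: real_sqrt_divide field_simps)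
      have "(6 * (\<mu> / h) + 2 * y\<^sup>2) * h\<^sup>2 = h * (6 * \<mu> + 2 * y\<^sup>2 * h)"
        using elim by (simp add: power2_eq_square distrib_right distrib_left)
      hence "sqrt (\<mu> / h) * ((6 * (\<mu> / h) + 2 * y\<^sup>2) * (h\<^sup>2 / c\<^sup>2))
        = (sqrt (\<mu> / h) * h) * ((6 * \<mu> + 2 * y\<^sup>2 * h) / c\<^sup>2)"
        by (simp only: times_divide_eq_right mult.assoc)
      also have "\<dots> = sqrt \<mu> * (6 * \<mu> * sqrt h + 2 * y\<^sup>2 * (h * sqrt h)) / c\<^sup>2"
        unfolding \<open>sqrt (\<mu> / h) * h = sqrt \<mu> * sqrt h\<close> by (simp add: divide_inverse algebra_simps)
      finally show ?thesis .
    qed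
    ultimately show ?case
      unfolding relative_defect_def parabola_defect_def far_mass_def mult.assoc
      by (simp add: real_sqrt_divide mult.assoc)
  qed
  ultimately show ?thesis by (simp add: tendsto_cong)
qed

text \<open>At time \<mu> h the walk has run for T = \<mu>/h. Dividing y = b x^2 / 2 by h at x = j h
  gives the coefficient a = b h / 2, so 2 a T = b \<mu>. The condition h <= \<mu> yields T >= 1, as
  the lower bound on the height requires.\<close>

lemma heat_solution_bounds:
  fixes w :: "int \<Rightarrow> int \<Rightarrow> real \<Rightarrow> real"
  assumes \<mu>: "0 < \<mu>" and h: "0 < h" "h \<le> \<mu>" and c: "0 < c" and \<Omega>: "bounded \<Omega>"
    and w: "bounded_heat_solution \<Omega> h w"
  shows "(\<And>x y. \<bar>x\<bar> < c \<Longrightarrow> \<bar>y\<bar> < c \<Longrightarrow> (x, y) \<in> \<Omega> \<Longrightarrow> y \<le> b / 2 * x\<^sup>2) \<Longrightarrow>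
      w 0 n (\<mu> * h) \<le> 1 / 2 + central_height (\<mu> / h) * (b * \<mu> - n + relative_defect \<mu> b c n h)"
    and "(\<And>x y. \<bar>x\<bar> < c \<Longrightarrow> \<bar>y\<bar> < c \<Longrightarrow> y \<le> b / 2 * x\<^sup>2 \<Longrightarrow> (x, y) \<in> \<Omega>) \<Longrightarrow>
      1 / 2 + central_height (\<mu> / h) * (b * \<mu> - n - relative_defect \<mu> b c n h) \<le> w 0 n (\<mu> * h)"
proof -
  let ?T = "\<mu> / h" and ?a = "b * h / 2" and ?q = "central_height (\<mu> / h)"
  let ?S = "{(j, k). (of_int j * h, of_int k * h) \<in> \<Omega>}"
  let ?S' = "{(j, i). (of_int j * h, of_int (i + n) * h) \<in> \<Omega>}"
  let ?P = "\<Sum>(j, i)\<in>?S'. walk_kernel ?T j * walk_kernel ?T i"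
  have T: "1 \<le> ?T" "0 < ?T" using h \<mu> by (simp_all add: field_simps)
  have S: "finite ?S" by (rule finite_lattice_points[OF \<Omega> h(1)])
  have S': "finite ?S'"
  proof (rule finite_surj[OF S], clarify)
    fix j i assume "(of_int j * h, of_int (i + n) * h) \<in> \<Omega>"
    thus "(j, i) \<in> (\<lambda>(j, k). (j, k - n)) ` ?S" by (intro image_eqI[of _ _ "(j, i + n)"]) auto
  qed
  have "w 0 n (\<mu> * h) = (\<Sum>(j, k)\<in>?S. walk_kernel ?T j * walk_kernel ?T (k - n))"
    using bounded_heat_solution_eq_sum[OF h(1) w S, of "\<mu> * h" 0 n] h \<mu>
    by (simp add: power2_eq_square)
  also have "\<dots> = ?P"
    by (rule sum.reindex_bij_witness[where i = "\<lambda>(j, i). (j, i + n)" and j = "\<lambda>(j, k). (j, k - n)"]) auto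
  finally have P: "w 0 n (\<mu> * h) = ?P" .
  have q: "1 / (28 * sqrt ?T) \<le> ?q" by (rule central_height_lower[OF T(1)])
  have "far_mass ?T h c n = 1 / (28 * sqrt ?T) * (28 * sqrt ?T * far_mass ?T h c n)"
  proof -
    have "z = 1 / x * (x * z)" if "x \<noteq> 0" for x z :: real using that by simp
    moreover have "28 * sqrt ?T \<noteq> 0" using T by (metis less_irrefl mult_eq_0_iff real_sqrt_gt_0_iff zero_neq_numeral)
    ultimately show ?thesis by blast
  qed
  also have "\<dots> \<le> ?q * (28 * sqrt ?T * far_mass ?T h c n)"
    using q T by (intro mult_right_mono) (auto simp: far_mass_def)
  finally have E: "?q * parabola_defect ?T ?a n + far_mass ?T h c n \<le> ?q * relative_defect \<mu> b c n h"
    by (simp add: relative_defect_def distrib_left)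
  have a: "2 * ?a * ?T = b * \<mu>" using h by simp
  have scale: "of_int k \<le> ?a * (of_int j)\<^sup>2 \<longleftrightarrow> of_int k * h \<le> b / 2 * (of_int j * h)\<^sup>2" for j k :: int
  proof -
    have "b / 2 * (of_int j * h)\<^sup>2 = ?a * (of_int j)\<^sup>2 * h" by (simp add: power2_eq_square)
    thus ?thesis by (simp only: mult_le_cancel_right_pos[OF h(1)])
  qed
  show "w 0 n (\<mu> * h) \<le> 1 / 2 + ?q * (b * \<mu> - n + relative_defect \<mu> b c n h)"
    if above: "\<And>x y. \<bar>x\<bar> < c \<Longrightarrow> \<bar>y\<bar> < c \<Longrightarrow> (x, y) \<in> \<Omega> \<Longrightarrow> y \<le> b / 2 * x\<^sup>2"
  proof -
    have "?P \<le> 1 / 2 + ?q * (2 * ?a * ?T - n) + (?q * parabola_defect ?T ?a n + far_mass ?T h c n)"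
    proof (rule lattice_set_walk_measure(1)[OF T(2) h(1) c S'])
      fix j i assume "\<bar>of_int j * h\<bar> < c" "\<bar>of_int (i + n) * h\<bar> < c" "(j, i) \<in> ?S'"
      thus "of_int (i + n) \<le> ?a * (of_int j)\<^sup>2" unfolding scale by (intro above) auto
    qed
    with E show ?thesis unfolding P a by (simp add: distrib_left)
  qed
  show "1 / 2 + ?q * (b * \<mu> - n - relative_defect \<mu> b c n h) \<le> w 0 n (\<mu> * h)"
    if below: "\<And>x y. \<bar>x\<bar> < c \<Longrightarrow> \<bar>y\<bar> < c \<Longrightarrow> y \<le> b / 2 * x\<^sup>2 \<Longrightarrow> (x, y) \<in> \<Omega>"
  proof -
    have "1 / 2 + ?q * (2 * ?a * ?T - n) - (?q * parabola_defect ?T ?a n + far_mass ?T h c n) \<le> ?P"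
    proof (rule lattice_set_walk_measure(2)[OF T(2) h(1) c S'])
      fix j i assume "\<bar>of_int j * h\<bar> < c" "\<bar>of_int (i + n) * h\<bar> < c"
        "of_int (i + n) \<le> ?a * (of_int j)\<^sup>2"
      thus "(j, i) \<in> ?S'" unfolding scale using below by auto
    qed
    with E show ?thesis unfolding P a by (simp add: right_diff_distrib)
  qed
qed

lemma central_height_pos: "1 \<le> T \<Longrightarrow> 0 < central_height T"
  using central_height_lower[of T] by (smt (verit) divide_pos_pos real_sqrt_gt_0_iff)

text \<open>The height is positive, so comparing \<open>w\<close> with 1/2 decides the sign of b
  \<mu> - n plus or minus the defect. The row \<open>n\<close> stays fixed as h tends to 0, and the
  defect tends to 1.\<close>

lemma discrete_velocity_bounds:
  fixes w :: "real \<Rightarrow> int \<Rightarrow> int \<Rightarrow> real \<Rightarrow> real" and n :: int and \<mu> b c :: real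
  assumes \<mu>: "0 < \<mu>" and c: "0 < c" and \<Omega>: "bounded \<Omega>"
    and w: "\<forall>h>0. bounded_heat_solution \<Omega> h (w h)"
  shows "\<lbrakk>\<And>x y. \<lbrakk>\<bar>x\<bar> < c; \<bar>y\<bar> < c; (x, y) \<in> \<Omega>\<rbrakk> \<Longrightarrow> y \<le> b / 2 * x\<^sup>2;
      \<forall>\<^sub>F h in at_right 0. 1 / 2 < w h 0 n (\<mu> * h)\<rbrakk> \<Longrightarrow> of_int n \<le> b * \<mu> + 1"
    and "\<lbrakk>\<And>x y. \<lbrakk>\<bar>x\<bar> < c; \<bar>y\<bar> < c; y \<le> b / 2 * x\<^sup>2\<rbrakk> \<Longrightarrow> (x, y) \<in> \<Omega>;
      \<forall>\<^sub>F h in at_right 0. w h 0 n (\<mu> * h) \<le> 1 / 2\<rbrakk> \<Longrightarrow> b * \<mu> - 1 \<le> of_int n"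
proof -
  have small: "\<forall>\<^sub>F h in at_right 0. 0 < h \<and> h \<le> \<mu>"
    by (rule eventually_mono[OF eventually_at_right_real[OF \<mu>]]) auto
  have q: "0 < central_height (\<mu> / h)" if "0 < h" "h \<le> \<mu>" for h
    using that by (intro central_height_pos) simp
  have R: "(relative_defect \<mu> b c n \<longlongrightarrow> 1) (at_right 0)" by (rule relative_defect_tendsto[OF \<mu> c])
  show "of_int n \<le> b * \<mu> + 1"
    if above: "\<And>x y. \<lbrakk>\<bar>x\<bar> < c; \<bar>y\<bar> < c; (x, y) \<in> \<Omega>\<rbrakk> \<Longrightarrow> y \<le> b / 2 * x\<^sup>2"
    and ev: "\<forall>\<^sub>F h in at_right 0. 1 / 2 < w h 0 n (\<mu> * h)"
  proof -
    have "\<forall>\<^sub>F h in at_right 0. of_int n \<le> b * \<mu> + relative_defect \<mu> b c n h"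
      using ev small
    proof eventually_elim
      case (elim h)
      have "1 / 2 < 1 / 2 + central_height (\<mu> / h) * (b * \<mu> - n + relative_defect \<mu> b c n h)"
        using heat_solution_bounds(1)[OF \<mu> _ _ c \<Omega> _ above, where h = h and w = "w h" and n = n] elim w by fastforce
      hence "0 < central_height (\<mu> / h) * (b * \<mu> - n + relative_defect \<mu> b c n h)" by simp
      thus ?case using q elim by (simp add: zero_less_mult_iff) (smt (verit))
    qed
    from tendsto_lowerbound[OF tendsto_add[OF tendsto_const R] this] show ?thesis by simp
  qed
  show "b * \<mu> - 1 \<le> of_int n"
    if below: "\<And>x y. \<lbrakk>\<bar>x\<bar> < c; \<bar>y\<bar> < c; y \<le> b / 2 * x\<^sup>2\<rbrakk> \<Longrightarrow> (x, y) \<in> \<Omega>"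
    and ev: "\<forall>\<^sub>F h in at_right 0. w h 0 n (\<mu> * h) \<le> 1 / 2"
  proof -
    have "\<forall>\<^sub>F h in at_right 0. b * \<mu> - relative_defect \<mu> b c n h \<le> of_int n"
      using ev small
    proof eventually_elim
      case (elim h)
      have "1 / 2 + central_height (\<mu> / h) * (b * \<mu> - n - relative_defect \<mu> b c n h) \<le> 1 / 2"
        using heat_solution_bounds(2)[OF \<mu> _ _ c \<Omega> _ below, where h = h and w = "w h" and n = n] elim w by fastforce
      hence "central_height (\<mu> / h) * (b * \<mu> - n - relative_defect \<mu> b c n h) \<le> 0" by simp
      thus ?case using q[of h] elim by (simp add: mult_le_0_iff)
    qed
    from tendsto_upperbound[OF tendsto_diff[OF tendsto_const R] this] show ?thesis by simp
  qed
qed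

theorem theorem3:
  fixes \<Omega>\<^sub>0 :: "(real \<times> real) set"
    and c\<^sub>0 \<kappa> :: real
    and f f' f'' :: "real \<Rightarrow> real"
    and w :: "real \<Rightarrow> int \<Rightarrow> int \<Rightarrow> real \<Rightarrow> real"
    and M :: "real set"
    and n\<^sub>0 :: "real \<Rightarrow> int"
  assumes domain: "bounded_C2_domain \<Omega>\<^sub>0"
    and c0_pos: "c\<^sub>0 > 0"
    and local_graph: "\<Omega>\<^sub>0 \<inter> ({-c\<^sub>0<..<c\<^sub>0} \<times> {-c\<^sub>0<..<c\<^sub>0}) =
          {(x, y). \<bar>x\<bar> < c\<^sub>0 \<and> - c\<^sub>0 < y \<and> y \<le> f x \<and> f x < c\<^sub>0}"
    and f_even: "\<forall>x \<in> {-c\<^sub>0<..<c\<^sub>0}. f (- x) = f x"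
    and f_deriv: "\<forall>x \<in> {-c\<^sub>0<..<c\<^sub>0}. (f has_real_derivative f' x) (at x)"
    and f'_deriv: "\<forall>x \<in> {-c\<^sub>0<..<c\<^sub>0}. (f' has_real_derivative f'' x) (at x)"
    and f''_cont: "continuous_on {-c\<^sub>0<..<c\<^sub>0} f''"
    and at_zero: "f 0 = 0" "f' 0 = 0" "f'' 0 = - \<kappa>" "- \<kappa> \<le> 0"
    and w_solution: "\<forall>h>0. bounded_heat_solution \<Omega>\<^sub>0 h (w h)"
    and M_pos: "M \<subseteq> {0<..}"
    and n0: "\<forall>\<mu> \<in> M. \<forall>\<^sub>F h in at_right 0.
          w h 0 (- n\<^sub>0 \<mu>) (\<mu> * h) \<le> 1 / 2 \<and> w h 0 (- n\<^sub>0 \<mu> - 1) (\<mu> * h) > 1 / 2"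
  shows "((\<lambda>\<mu>. of_int (n\<^sub>0 \<mu>) / \<mu>) \<longlongrightarrow> \<kappa>) (inf at_top (principal M))"
proof -
  have \<Omega>: "bounded \<Omega>\<^sub>0" using domain by (simp add: bounded_C2_domain_def)
  have local: "\<exists>c>0. \<forall>x y. \<bar>x\<bar> < c \<longrightarrow> \<bar>y\<bar> < c \<longrightarrow>
      ((x, y) \<in> \<Omega>\<^sub>0 \<longrightarrow> y \<le> (- \<kappa> + \<epsilon>) / 2 * x\<^sup>2) \<and> (y \<le> (- \<kappa> - \<epsilon>) / 2 * x\<^sup>2 \<longrightarrow> (x, y) \<in> \<Omega>\<^sub>0)"
    if \<epsilon>: "0 < \<epsilon>" for \<epsilon>
  proof -
    have "(f' has_real_derivative - \<kappa>) (at 0)" using f'_deriv[rule_format, of 0] c0_pos at_zero by simp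
    from quadratic_expansion[OF c0_pos f_deriv this at_zero(1,2) \<epsilon>]
    obtain c where c: "0 < c" "c \<le> c\<^sub>0"
      and f: "\<And>x. \<bar>x\<bar> < c \<Longrightarrow> \<bar>f x - - \<kappa> / 2 * x\<^sup>2\<bar> \<le> \<epsilon> / 2 * x\<^sup>2" by blast
    \<comment> \<open>The local description also demands f x < \<open>c\<^sub>0\<close>; continuity
      at 0 provides this on a smaller chart.\<close>
    have "isCont f 0" using f_deriv c0_pos by (intro DERIV_isCont) auto
    hence "f \<midarrow>0\<rightarrow> 0" using at_zero by (simp add: isCont_def)
    from LIM_D[OF this c0_pos] obtain d where d: "0 < d" "\<And>x. x \<noteq> 0 \<Longrightarrow> \<bar>x\<bar> < d \<Longrightarrow> \<bar>f x\<bar> < c\<^sub>0"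
      by auto
    have mem: "(x, y) \<in> \<Omega>\<^sub>0 \<longleftrightarrow> y \<le> f x" if "\<bar>x\<bar> < min c d" "\<bar>y\<bar> < min c d" for x y
    proof -
      have "\<bar>f x\<bar> < c\<^sub>0" using d(2)[of x] that at_zero c0_pos by (cases "x = 0") auto
      moreover have "(x, y) \<in> {-c\<^sub>0<..<c\<^sub>0} \<times> {-c\<^sub>0<..<c\<^sub>0}" using that c by auto
      hence "(x, y) \<in> \<Omega>\<^sub>0 \<longleftrightarrow> (x, y) \<in> {(x, y). \<bar>x\<bar> < c\<^sub>0 \<and> - c\<^sub>0 < y \<and> y \<le> f x \<and> f x < c\<^sub>0}"
        using local_graph by blast
      ultimately show ?thesis using that c by auto
    qed
    show ?thesis
    proof (intro exI[of _ "min c d"] conjI allI impI)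
      fix x y assume xy: "\<bar>x\<bar> < min c d" "\<bar>y\<bar> < min c d"
      have fx: "f x \<le> (- \<kappa> + \<epsilon>) / 2 * x\<^sup>2" "(- \<kappa> - \<epsilon>) / 2 * x\<^sup>2 \<le> f x"
        using f[of x] xy by (auto simp: abs_le_iff field_simps)
      show "y \<le> (- \<kappa> + \<epsilon>) / 2 * x\<^sup>2" if "(x, y) \<in> \<Omega>\<^sub>0" using mem[OF xy] that fx by simp
      show "(x, y) \<in> \<Omega>\<^sub>0" if "y \<le> (- \<kappa> - \<epsilon>) / 2 * x\<^sup>2" using mem[OF xy] that fx by simp
    qed (use c d in auto)
  qed
  \<comment> \<open>The constant is 1 for rounding plus 1 because the value above 1/2 is taken one
    row lower, at \<open>- n\<^sub>0 \<mu> - 1\<close>.\<close>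
  have est: "\<bar>of_int (n\<^sub>0 \<mu>) - \<kappa> * \<mu>\<bar> \<le> 2" if \<mu>: "\<mu> \<in> M" for \<mu>
  proof -
    have pos: "0 < \<mu>" using M_pos \<mu> by auto
    have ev: "\<forall>\<^sub>F h in at_right 0. w h 0 (- n\<^sub>0 \<mu>) (\<mu> * h) \<le> 1 / 2"
      "\<forall>\<^sub>F h in at_right 0. 1 / 2 < w h 0 (- n\<^sub>0 \<mu> - 1) (\<mu> * h)"
      using n0 \<mu> by (auto elim: eventually_mono)
    have le: "\<bar>of_int (n\<^sub>0 \<mu>) - \<kappa> * \<mu>\<bar> \<le> 2 + e" if e: "0 < e" for e
    proof -
      \<comment> \<open>The curvature tolerance e/\<mu> is multiplied by \<mu> in the bounds and
        costs e. The chart size then depends on e and \<mu>, harmlessly, because h tends to 0 while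
        both are fixed.\<close>
      obtain c where c: "0 < c" and
        C: "\<And>x y. \<bar>x\<bar> < c \<Longrightarrow> \<bar>y\<bar> < c \<Longrightarrow> (x, y) \<in> \<Omega>\<^sub>0 \<Longrightarrow> y \<le> (- \<kappa> + e / \<mu>) / 2 * x\<^sup>2"
        "\<And>x y. \<bar>x\<bar> < c \<Longrightarrow> \<bar>y\<bar> < c \<Longrightarrow> y \<le> (- \<kappa> - e / \<mu>) / 2 * x\<^sup>2 \<Longrightarrow> (x, y) \<in> \<Omega>\<^sub>0"
        using local[of "e / \<mu>"] e pos by (metis divide_pos_pos)
      have "of_int (- n\<^sub>0 \<mu> - 1) \<le> (- \<kappa> + e / \<mu>) * \<mu> + 1"
        by (rule discrete_velocity_bounds(1)[OF pos c \<Omega> w_solution C(1) ev(2)])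
      moreover have "(- \<kappa> - e / \<mu>) * \<mu> - 1 \<le> of_int (- n\<^sub>0 \<mu>)"
        by (rule discrete_velocity_bounds(2)[OF pos c \<Omega> w_solution C(2) ev(1)])
      ultimately show ?thesis using pos by (simp add: algebra_simps abs_le_iff)
    qed
    show ?thesis by (rule field_le_epsilon) (rule le)
  qed
  have "((\<lambda>\<mu>. of_int (n\<^sub>0 \<mu>) / \<mu> - \<kappa>) \<longlongrightarrow> 0) (inf at_top (principal M))"
  proof (rule Lim_null_comparison)
    have "((\<lambda>\<mu>::real. 2 / \<mu>) \<longlongrightarrow> 0) at_top" by real_asymp
    thus "((\<lambda>\<mu>::real. 2 / \<mu>) \<longlongrightarrow> 0) (inf at_top (principal M))" by (rule tendsto_mono[rotated]) simp
    have "norm (of_int (n\<^sub>0 \<mu>) / \<mu> - \<kappa>) \<le> 2 / \<mu>" if \<mu>: "\<mu> \<in> M" for \<mu>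
    proof -
      have pos: "0 < \<mu>" using M_pos \<mu> by auto
      hence "of_int (n\<^sub>0 \<mu>) / \<mu> - \<kappa> = (of_int (n\<^sub>0 \<mu>) - \<kappa> * \<mu>) / \<mu>" by (simp add: field_simps)
      thus ?thesis using est[OF \<mu>] pos by (simp add: divide_right_mono)
    qed
    thus "\<forall>\<^sub>F \<mu> in inf at_top (principal M). norm (of_int (n\<^sub>0 \<mu>) / \<mu> - \<kappa>) \<le> 2 / \<mu>"
      by (simp add: eventually_inf_principal)
  qed
  thus ?thesis by (simp add: LIM_zero_iff)
qed

end
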